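(* Let $d\in\mathbb{N}$, $\alpha_1,\dots,\alpha_d\in(0,1]$ and $A=(a_{ij})\in\mathbb{C}^{d\times d}$. Consider the homogeneous multi-order system $$D_*^{\alpha_i}x_i(t)=\sum_{j=1}^d a_{ij}x_j(t),\qquad i=1,\dots,d,\ t>0,$$ and let $\Delta(s)=\operatorname{diag}(s^{\alpha_1},\dots,s^{\alpha_d})-A$. If all the roots $s\in\mathbb{C}$ of the characteristic equation $\det\Delta(s)=0$ have negative real parts, then all solutions of the system converge to zero as $t\to\infty$.
   Context: $D_*^{\alpha}$ denotes the Caputo derivative of order $\alpha$. By definition, a solution of the system with initial condition $x(0)=x_0=(x_1^0,\dots,x_d^0)^\top\in\mathbb{C}^d$ is a continuous function $x=(x_1,\dots,x_d)^\top:[0,\infty)\to\mathbb{C}^d$ satisfying $$x_i(t)=x_i^0+\frac{1}{\Gamma(\alpha_i)}\int_0^t(t-s)^{\alpha_i-1}\sum_{j=1}^d a_{ij}x_j(s)\,ds\qquad\text{for all } t\ge0,\ 1\le i\le d.$$ For every $x_0\in\mathbb{C}^d$ there is exactly one such solution. The powers $s^{\alpha_i}$ are principal values ($\arg s\in(-\pi,\pi]$), with $0^{\alpha_i}=0$; in particular $s=0$ counts as a root of the characteristic equation if $\det A=0$. *)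

theory Defs
  imports "HOL-Analysis.Analysis"
begin

definition rl_integral :: "real \<Rightarrow> (real \<Rightarrow> complex) \<Rightarrow> real \<Rightarrow> complex" where
  "rl_integral a f t =
     (1 / Gamma a) *\<^sub>R integral {0..t} (\<lambda>s. ((t - s) powr (a - 1)) *\<^sub>R f s)"

text \<open>
  Solutions of the Caputo system are taken in the sense of the equivalent Volterra integral
  equation. Only the values \<open>x t\<close> for \<open>t \<ge> 0\<close> matter; the equation at \<open>t = 0\<close> gives
  \<open>x 0 = x0\<close>.
\<close>

definition multi_order_solution ::
  "('d::finite \<Rightarrow> real) \<Rightarrow> complex^'d^'d \<Rightarrow> complex^'d \<Rightarrow> (real \<Rightarrow> complex^'d) \<Rightarrow> bool" where
  "multi_order_solution \<alpha> A x0 x \<longleftrightarrow>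
     continuous_on {0..} x \<and>
     (\<forall>t\<ge>0. \<forall>i. x t $ i = x0 $ i + rl_integral (\<alpha> i) (\<lambda>s. \<Sum>j\<in>UNIV. A $ i $ j * x s $ j) t)"

text \<open>
  The complex \<open>powr\<close> is the principal value (imaginary part of \<open>Ln\<close> in \<open>(-\<pi>, \<pi>]\<close>), with
  \<open>0 powr w = 0\<close>.
\<close>

definition char_matrix ::
  "('d::finite \<Rightarrow> real) \<Rightarrow> complex^'d^'d \<Rightarrow> complex \<Rightarrow> complex^'d^'d" where
  "char_matrix \<alpha> A s = (\<chi> i j. if i = j then s powr of_real (\<alpha> i) else 0) - A"

end

theory Submission
  imports Defs "HOL-Probability.Probability" "HOL-Complex_Analysis.Complex_Analysis"
begin

no_notation fps_nth (infixl \<open>$\<close> 75)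

text \<open>
  A solution grows at most exponentially (compare it with its weighted supremum on \<open>[0, T]\<close>),
  so its Laplace transform exists for large \<open>Re s\<close> and equals there
  \<open>Y s = \<Delta>(s)\<^sup>-\<^sup>1 (s powr (\<alpha>\<^sub>i - 1) x0\<^sub>i)\<^sub>i\<close>, which by Cramer's rule is holomorphic on the whole
  half-plane \<open>Re s > 0\<close>. A compactness argument for bounded \<open>s\<close> (including \<open>s = 0\<close>) and a
  contraction argument for large \<open>s\<close> give \<open>\<bar>Y' s\<bar> \<le> C \<bar>s\<bar> powr (a - 2)\<close> on this half-plane, for
  any \<open>a < 1\<close> with \<open>0 < a \<le> \<alpha>\<^sub>i\<close> for all \<open>i\<close>. Unlike \<open>Y\<close> itself, \<open>Y'\<close> is thus integrable on vertical
  lines, and Fourier inversion yields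
  \<open>t x(t) = -1/(2\<pi>) \<integral> e\<^sup>s\<^sup>t Y' s d(Im s)\<close>. The line of integration may be moved to \<open>Re s = 1/t\<close>,
  where the bound gives \<open>\<bar>t x(t)\<bar> \<le> C' t powr (1 - a)\<close>, that is \<open>x(t) = O(t powr (- a))\<close>.
  No continuation of \<open>Y\<close> beyond the imaginary axis is needed.
\<close>

section \<open>The Laplace transform\<close>

lemma norm_lebesgue_integral_le:
  fixes f :: "'a \<Rightarrow> 'b::{banach, second_countable_topology}"
  assumes "integrable M f" "integrable M g" "\<And>x. norm (f x) \<le> g x"
  shows "norm (\<integral>x. f x \<partial>M) \<le> (\<integral>x. g x \<partial>M)"
proof -
  have "norm (\<integral>x. f x \<partial>M) \<le> (\<integral>x. norm (f x) \<partial>M)" by (rule integral_norm_bound)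
  also have "\<dots> \<le> (\<integral>x. g x \<partial>M)" using assms by (intro integral_mono integrable_norm)
  finally show ?thesis .
qed

text \<open>The integral runs over the whole line, so that affine substitutions and Fubini for
  \<open>lborel\<close> apply directly. For functions vanishing on the negative axis it is the usual
  one-sided transform.\<close>

definition laplace :: "(real \<Rightarrow> complex) \<Rightarrow> complex \<Rightarrow> complex" where
  "laplace f s = (\<integral>t. exp (- (s * of_real t)) * f t \<partial>lborel)"

text \<open>Integrability is required for every \<open>b > c\<close> but not at
  \<open>b = c\<close>. With this convention the class for a fixed \<open>c\<close> is closed under
  multiplication by \<open>t\<close>, hence under differentiating the transform.\<close>

definition exp_integrable :: "real \<Rightarrow> (real \<Rightarrow> complex) \<Rightarrow> bool" where
  "exp_integrable c f \<longleftrightarrow> f \<in> borel_measurable borel \<and> (\<forall>t<0. f t = 0) \<and>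
     (\<forall>b>c. integrable lborel (\<lambda>t. exp (- (b * t)) *\<^sub>R f t))"

lemma integrable_laplace_integrand:
  assumes "exp_integrable c f" "Re s > c"
  shows "integrable lborel (\<lambda>t. exp (- (s * of_real t)) * f t)"
proof (rule Bochner_Integration.integrable_bound)
  show "integrable lborel (\<lambda>t. exp (- (Re s * t)) *\<^sub>R f t)"
    using assms by (auto simp: exp_integrable_def)
  show "(\<lambda>t. exp (- (s * of_real t)) * f t) \<in> borel_measurable lborel"
    using assms by (auto simp: exp_integrable_def)
qed (auto simp: norm_mult)

lemma mult_exp_le:
  fixes t d :: real assumes "t \<ge> 0" "d > 0"
  shows "t \<le> exp (d * t) / d"
proof -
  have "d * t \<le> exp (d * t)"
    using exp_ge_add_one_self[of "d * t"] by linarith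
  with assms show ?thesis by (simp add: field_simps)
qed

lemma exp_integrable_times:
  assumes "exp_integrable c f"
  shows "exp_integrable c (\<lambda>t. of_real t * f t)"
  unfolding exp_integrable_def
proof (intro conjI allI impI)
  have [measurable]: "f \<in> borel_measurable borel"
    using assms by (auto simp: exp_integrable_def)
  show "(\<lambda>t. of_real t * f t) \<in> borel_measurable borel" by measurable
  show "of_real t * f t = 0" if "t < 0" for t
    using that assms by (auto simp: exp_integrable_def)
  fix b assume b: "b > c"
  \<comment> \<open>Half of the gap between \<open>b\<close> and \<open>c\<close> is spent on the
    factor \<open>t\<close>, which is at most \<open>exp (d * t) / d\<close>; the remaining rate
    \<open>b - d\<close> still exceeds \<open>c\<close>.\<close>
  define d where "d = (b - c) / 2"
  have d: "d > 0" "b - d > c" using b by (auto simp: d_def field_simps)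
  show "integrable lborel (\<lambda>t. exp (- (b * t)) *\<^sub>R (of_real t * f t))"
  proof (rule Bochner_Integration.integrable_bound)
    show "integrable lborel (\<lambda>t. (1 / d) *\<^sub>R (exp (- ((b - d) * t)) *\<^sub>R f t))"
      using assms d by (intro integrable_scaleR_right) (auto simp: exp_integrable_def)
    have "norm (exp (- (b * t)) *\<^sub>R (of_real t * f t)) \<le> norm ((1 / d) *\<^sub>R (exp (- ((b - d) * t)) *\<^sub>R f t))" for t
    proof (cases "t < 0")
      case True
      then show ?thesis using assms by (auto simp: exp_integrable_def)
    next
      case False
      then have "t \<le> exp (d * t) / d" using mult_exp_le d by auto
      then have "exp (- (b * t)) * t * norm (f t) \<le> exp (- (b * t)) * (exp (d * t) / d) * norm (f t)"
        by (intro mult_right_mono mult_left_mono) auto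
      also have "\<dots> = exp (- ((b - d) * t)) / d * norm (f t)"
        by (simp add: exp_add [symmetric] algebra_simps)
      finally show ?thesis using False d by (simp add: norm_mult)
    qed
    then show "AE t in lborel. norm (exp (- (b * t)) *\<^sub>R (of_real t * f t)) \<le> norm ((1 / d) *\<^sub>R (exp (- ((b - d) * t)) *\<^sub>R f t))"
      by simp
  qed auto
qed

text \<open>Differentiation under the integral by an explicit quadratic remainder: the error of
  linearizing the exponential costs a factor \<open>t\<close> squared and
  \<open>exp (d * t)\<close>, both of which the gap between \<open>Re s\<close> and \<open>c\<close>
  absorbs. The remainder is then at most \<open>C * norm h ^ 2\<close>.\<close>

lemma laplace_has_field_derivative:
  assumes f: "exp_integrable c f" and s: "Re s > c"
  shows "(laplace f has_field_derivative - laplace (\<lambda>t. of_real t * f t) s) (at s)"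
proof -
  define d where "d = (Re s - c) / 2"
  have d: "d > 0" "Re s - d > c" using s by (auto simp: d_def field_simps)
  define g where "g = (\<lambda>t. of_real t * (of_real t * f t))"
  have f1: "exp_integrable c (\<lambda>t. of_real t * f t)" by (rule exp_integrable_times[OF f])
  have g: "exp_integrable c g" unfolding g_def by (intro exp_integrable_times f)
  define C where "C = (\<integral>t. norm (exp (- ((Re s - d) * t)) *\<^sub>R g t) \<partial>lborel)"
  have bnd: "norm (laplace f (s + h) - laplace f s - (- laplace (\<lambda>t. of_real t * f t) s) * h) \<le> C * norm h ^ 2"
    if h: "norm h \<le> d" for h
  proof -
    have sh: "Re (s + h) > c"
      using abs_Re_le_cmod[of h] h d by auto
    have "laplace f (s + h) - laplace f s - (- laplace (\<lambda>t. of_real t * f t) s) * h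
        = (\<integral>t. exp (- ((s + h) * of_real t)) * f t - exp (- (s * of_real t)) * f t
              + exp (- (s * of_real t)) * (of_real t * f t) * h \<partial>lborel)"
      unfolding laplace_def
      using integrable_laplace_integrand[OF f sh] integrable_laplace_integrand[OF f s]
        integrable_laplace_integrand[OF f1 s]
      by (simp add: Bochner_Integration.integral_diff Bochner_Integration.integral_add)
    also have "norm \<dots> \<le> (\<integral>t. norm h ^ 2 * norm (exp (- ((Re s - d) * t)) *\<^sub>R g t) \<partial>lborel)"
    proof (rule norm_lebesgue_integral_le)
      show "integrable lborel (\<lambda>t. exp (- ((s + h) * of_real t)) * f t - exp (- (s * of_real t)) * f t
              + exp (- (s * of_real t)) * (of_real t * f t) * h)"
        using integrable_laplace_integrand[OF f sh] integrable_laplace_integrand[OF f s]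
          integrable_laplace_integrand[OF f1 s] by auto
      show "integrable lborel (\<lambda>t. norm h ^ 2 * norm (exp (- ((Re s - d) * t)) *\<^sub>R g t))"
        using g d unfolding exp_integrable_def by (intro integrable_mult_right integrable_norm) auto
      fix t :: real
      show "norm (exp (- ((s + h) * of_real t)) * f t - exp (- (s * of_real t)) * f t
              + exp (- (s * of_real t)) * (of_real t * f t) * h) \<le> norm h ^ 2 * norm (exp (- ((Re s - d) * t)) *\<^sub>R g t)"
      proof (cases "t < 0")
        case True
        then show ?thesis using f by (auto simp: exp_integrable_def)
      next
        case False
        \<comment> \<open>The integrand is \<open>exp (- (s * of_real t)) * f t\<close> times the
          error of the linear Taylor polynomial of the exponential at \<open>z\<close>.\<close>
        define z where "z = - (h * of_real t)"
        have "exp (- ((s + h) * of_real t)) * f t - exp (- (s * of_real t)) * f t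
              + exp (- (s * of_real t)) * (of_real t * f t) * h
            = exp (- (s * of_real t)) * f t * (exp z - (\<Sum>k\<le>1. z ^ k / fact k))"
          by (simp add: z_def algebra_simps exp_add exp_diff exp_minus divide_inverse)
        also have "norm \<dots> = exp (- (Re s * t)) * norm (f t) * norm (exp z - (\<Sum>k\<le>1. z ^ k / fact k))"
          by (simp add: norm_mult)
        also have "\<dots> \<le> exp (- (Re s * t)) * norm (f t) * (exp \<bar>Re z\<bar> * norm z ^ Suc 1 / fact 1)"
          by (intro mult_left_mono Taylor_exp) auto
        also have "\<dots> = exp (- (Re s * t)) * exp (\<bar>Re h\<bar> * t) * (norm (f t) * (norm h * t) ^ 2)"
          using False by (simp add: z_def norm_mult power2_eq_square abs_mult)
        also have "\<dots> \<le> exp (- (Re s * t)) * exp (d * t) * (norm (f t) * (norm h * t) ^ 2)"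
          using abs_Re_le_cmod[of h] h False
          by (intro mult_right_mono mult_left_mono) (auto intro!: mult_right_mono)
        also have "\<dots> = norm h ^ 2 * norm (exp (- ((Re s - d) * t)) *\<^sub>R g t)"
          using False by (simp add: g_def norm_mult power2_eq_square exp_add [symmetric] algebra_simps)
        finally show ?thesis .
      qed
    qed
    also have "\<dots> = C * norm h ^ 2"
      by (simp add: C_def)
    finally show ?thesis .
  qed
  have "((\<lambda>h. norm (laplace f (s + h) - laplace f s - (- laplace (\<lambda>t. of_real t * f t) s) * h) / norm h) \<longlongrightarrow> 0) (at 0)"
  proof (rule Lim_null_comparison)
    show "((\<lambda>h. C * norm h) \<longlongrightarrow> 0) (at (0::complex))"
      by (auto intro!: tendsto_eq_intros)
    have "eventually (\<lambda>h::complex. h \<in> ball 0 d - {0}) (at 0)"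
      using d by (intro eventually_at_in_open) auto
    then show "eventually (\<lambda>h. norm (norm (laplace f (s + h) - laplace f s - (- laplace (\<lambda>t. of_real t * f t) s) * h) / norm h) \<le> C * norm h) (at 0)"
    proof eventually_elim
      case (elim h)
      then have "norm (laplace f (s + h) - laplace f s - (- laplace (\<lambda>t. of_real t * f t) s) * h) / norm h \<le> C * norm h ^ 2 / norm h"
        by (intro divide_right_mono bnd) auto
      also have "\<dots> = C * norm h" using elim by (simp add: power2_eq_square)
      finally show ?case by simp
    qed
  qed
  then show ?thesis
    unfolding has_field_derivative_def has_derivative_at by (simp add: bounded_linear_mult_right mult.commute)
qed

lemma laplace_holomorphic:
  assumes "exp_integrable c f"
  shows "laplace f holomorphic_on {s. Re s > c}"
  using laplace_has_field_derivative[OF assms]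
  by (auto simp: holomorphic_on_def field_differentiable_def intro: has_field_derivative_at_within)

section \<open>The Riemann--Liouville kernel\<close>

text \<open>Convolution kernel of the fractional integral of order \<open>a\<close>, cut off at
  \<open>0\<close> so that an integral over \<open>{0..t}\<close> becomes a convolution on the whole
  line.\<close>

definition rl_kernel :: "real \<Rightarrow> real \<Rightarrow> real" where
  "rl_kernel a t = (if t > 0 then t powr (a - 1) / Gamma a else 0)"

lemma rl_kernel_measurable [measurable]: "rl_kernel a \<in> borel_measurable borel"
  unfolding rl_kernel_def by measurable

lemma rl_kernel_nonneg: "a > 0 \<Longrightarrow> rl_kernel a t \<ge> 0"
  by (simp add: rl_kernel_def Gamma_real_nonneg)

text \<open>For \<open>c = 1\<close> this is Euler's integral for \<open>Gamma a\<close>, computed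
  as a nonnegative integral so that integrability comes with the value. Substituting
  \<open>c * t\<close> gives the general case.\<close>

lemma rl_kernel_laplace_real:
  assumes a: "a > 0" and c: "c > 0"
  shows "integrable lborel (\<lambda>t. exp (- (c * t)) * rl_kernel a t)"
    and "(\<integral>t. exp (- (c * t)) * rl_kernel a t \<partial>lborel) = c powr (- a)"
proof -
  define f where "f = (\<lambda>t. exp (- t) * rl_kernel a t)"
  have f_nonneg: "f t \<ge> 0" for t
    using a by (auto simp: f_def rl_kernel_nonneg)
  have f_meas: "f \<in> borel_measurable borel" unfolding f_def by measurable
  have G: "Gamma a > 0" using a by (rule Gamma_real_pos)
  have "(\<integral>\<^sup>+t. ennreal (f t) \<partial>lborel) = (\<integral>\<^sup>+t. ennreal (1 / Gamma a) * ennreal (indicator {0..} t * t powr (a - 1) / exp t) \<partial>lborel)"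
    using G by (intro nn_integral_cong) (auto simp: f_def rl_kernel_def indicator_def exp_minus field_simps simp flip: ennreal_mult)
  also have "\<dots> = ennreal (1 / Gamma a) * ennreal (Gamma a)"
    using Gamma_conv_nn_integral_real[OF a] by (subst nn_integral_cmult) auto
  also have "\<dots> = 1" using G by (simp flip: ennreal_mult)
  finally have "has_bochner_integral lborel f 1"
    using f_nonneg by (intro has_bochner_integral_nn_integral) (simp_all add: f_meas)
  then have "has_bochner_integral lborel (\<lambda>t. f (0 + c * t)) (1 /\<^sub>R \<bar>c\<bar>)"
    using lborel_has_bochner_integral_real_affine_iff[of c f 1 0] c by simp
  \<comment> \<open>The factor \<open>c powr (1 - a)\<close> cancels the power of \<open>c\<close>
    that scaling pulls out of \<open>(c * t) powr (a - 1)\<close>.\<close>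
  then have "has_bochner_integral lborel (\<lambda>t. c powr (1 - a) * f (0 + c * t)) (c powr (1 - a) * (1 /\<^sub>R \<bar>c\<bar>))"
    by (rule has_bochner_integral_mult_right)
  also have "c powr (1 - a) * (1 /\<^sub>R \<bar>c\<bar>) = c powr (- a)"
    using c by (simp add: powr_diff powr_minus field_simps)
  also have "(\<lambda>t. c powr (1 - a) * f (0 + c * t)) = (\<lambda>t. exp (- (c * t)) * rl_kernel a t)"
    using c by (auto simp: f_def rl_kernel_def fun_eq_iff powr_mult zero_less_mult_iff powr_diff)
  finally have *: "has_bochner_integral lborel (\<lambda>t. exp (- (c * t)) * rl_kernel a t) (c powr (- a))" .
  show "integrable lborel (\<lambda>t. exp (- (c * t)) * rl_kernel a t)"
    and "(\<integral>t. exp (- (c * t)) * rl_kernel a t \<partial>lborel) = c powr (- a)"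
    using * by (auto simp: has_bochner_integral_iff)
qed

lemma exp_integrable_rl_kernel:
  assumes "a > 0"
  shows "exp_integrable 0 (\<lambda>t. of_real (rl_kernel a t))"
  unfolding exp_integrable_def
proof (intro conjI allI impI)
  fix b :: real assume "b > 0"
  from rl_kernel_laplace_real(1)[OF assms this]
  have "integrable lborel (\<lambda>t. complex_of_real (exp (- (b * t)) * rl_kernel a t))"
    by (rule integrable_of_real)
  then show "integrable lborel (\<lambda>t. exp (- (b * t)) *\<^sub>R complex_of_real (rl_kernel a t))"
    by (simp add: scaleR_conv_of_real)
qed (auto simp: rl_kernel_def)

text \<open>Both sides are holomorphic on the right half-plane and agree on the positive reals,
  which accumulate at \<open>1\<close>; the identity theorem does the rest.\<close>

lemma laplace_rl_kernel:
  assumes a: "a > 0" and s: "Re s > 0"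
  shows "laplace (\<lambda>t. of_real (rl_kernel a t)) s = s powr (- of_real a)"
proof -
  define S where "S = {s. Re s > 0}"
  have S: "open S" "connected S"
    unfolding S_def by (auto simp: open_halfspace_Re_gt convex_halfspace_Re_gt intro: convex_connected)
  have "laplace (\<lambda>t. of_real (rl_kernel a t)) s - s powr (- of_real a) = 0"
  proof (rule analytic_continuation[where f = "\<lambda>s. laplace (\<lambda>t. of_real (rl_kernel a t)) s - s powr (- of_real a)" and S = S and \<xi> = 1 and U = "of_real ` {0<..}"])
    show "(\<lambda>s. laplace (\<lambda>t. of_real (rl_kernel a t)) s - s powr (- of_real a)) holomorphic_on S"
      using laplace_holomorphic[OF exp_integrable_rl_kernel[OF a]]
      by (intro holomorphic_intros) (auto simp: S_def complex_nonpos_Reals_iff)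
    show "(1::complex) islimpt of_real ` {0<..}"
    proof -
      have "(1::real) islimpt {0<..}"
  by (intro interior_limit_point) (simp add: interior_open)
      then show ?thesis
        using islimpt_isCont_image[of "1::real" "{0<..}" complex_of_real]
        by (auto simp: eventually_at_filter)
    qed
    fix z :: complex assume "z \<in> of_real ` {0<..}"
    then obtain c :: real where c: "c > 0" "z = of_real c" by auto
    have "laplace (\<lambda>t. of_real (rl_kernel a t)) z = (\<integral>t. complex_of_real (exp (- (c * t)) * rl_kernel a t) \<partial>lborel)"
      unfolding laplace_def c(2) by (intro Bochner_Integration.integral_cong) (simp_all flip: exp_of_real)
    also have "\<dots> = of_real (\<integral>t. exp (- (c * t)) * rl_kernel a t \<partial>lborel)"
      by (rule integral_complex_of_real)
    also have "\<dots> = z powr (- of_real a)"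
      using rl_kernel_laplace_real(2)[OF a c(1)] c powr_of_real[of c "- a"] by simp
    finally show "laplace (\<lambda>t. of_real (rl_kernel a t)) z - z powr (- of_real a) = 0" by simp
  qed (use S s in \<open>auto simp: S_def\<close>)
  then show ?thesis by simp
qed

section \<open>Convolutions, and the fractional integral as one of them\<close>

text \<open>Fubini: by translation invariance the inner integral over \<open>t\<close> does not
  depend on \<open>u\<close>. Applied to exponentially weighted factors, this is the product rule
  for Laplace transforms of convolutions.\<close>

lemma convolution_integral:
  fixes k f :: "real \<Rightarrow> complex"
  assumes k: "integrable lborel k" and f: "integrable lborel f"
  shows "integrable lborel (\<lambda>t. \<integral>u. k (t - u) * f u \<partial>lborel)"
    and "(\<integral>t. (\<integral>u. k (t - u) * f u \<partial>lborel) \<partial>lborel) = (\<integral>t. k t \<partial>lborel) * (\<integral>t. f t \<partial>lborel)"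
proof -
  have [measurable]: "k \<in> borel_measurable borel" "f \<in> borel_measurable borel"
    using k f borel_measurable_integrable by force+
  have tr: "(\<integral>t. k (t - u) \<partial>lborel) = (\<integral>t. k t \<partial>lborel)"
    "(\<integral>t. norm (k (t - u)) \<partial>lborel) = (\<integral>t. norm (k t) \<partial>lborel)"
    "integrable lborel (\<lambda>t. k (t - u))" for u
    using lborel_integral_real_affine[of 1 k "-u"] lborel_integral_real_affine[of 1 "\<lambda>x. norm (k x)" "-u"]
      lborel_integrable_real_affine[OF k, of 1 "-u"] by simp_all
  have I: "integrable (lborel \<Otimes>\<^sub>M lborel) (\<lambda>(u, t). k (t - u) * f u)"
  proof (rule lborel_pair.Fubini_integrable)
    show "(\<lambda>(u, t). k (t - u) * f u) \<in> borel_measurable (lborel \<Otimes>\<^sub>M lborel)"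
      by measurable
    show "integrable lborel (\<lambda>u. \<integral>t. norm (case (u, t) of (u, t) \<Rightarrow> k (t - u) * f u) \<partial>lborel)"
      using f by (simp add: norm_mult tr)
    show "AE u in lborel. integrable lborel (\<lambda>t. case (u, t) of (u, t) \<Rightarrow> k (t - u) * f u)"
      by (simp add: tr)
  qed
  show "integrable lborel (\<lambda>t. \<integral>u. k (t - u) * f u \<partial>lborel)"
    using lborel_pair.integrable_snd[OF I] by simp
  have "(\<integral>t. (\<integral>u. k (t - u) * f u \<partial>lborel) \<partial>lborel) = (\<integral>u. (\<integral>t. k (t - u) * f u \<partial>lborel) \<partial>lborel)"
    by (rule lborel_pair.Fubini_integral[OF I])
  also have "\<dots> = (\<integral>t. k t \<partial>lborel) * (\<integral>t. f t \<partial>lborel)"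
    by (simp add: tr)
  finally show "(\<integral>t. (\<integral>u. k (t - u) * f u \<partial>lborel) \<partial>lborel) = (\<integral>t. k t \<partial>lborel) * (\<integral>t. f t \<partial>lborel)" .
qed

text \<open>Extension by zero turns the gauge integral over \<open>{0..t}\<close> into a Lebesgue
  integral over the line. Since the kernel may be singular at \<open>u = t\<close>, integrability is
  taken from the damped kernel reflected at \<open>t\<close>, with the bound of \<open>f\<close> on
  \<open>{0..t}\<close> as a factor.\<close>

lemma rl_integral_eq_convolution:
  fixes f :: "real \<Rightarrow> complex"
  assumes a: "a > 0" and t: "t \<ge> 0" and f: "continuous_on {0..} f"
  shows "integrable lborel (\<lambda>u. of_real (rl_kernel a (t - u)) * (indicator {0..} u *\<^sub>R f u))"
    and "rl_integral a f t = (\<integral>u. of_real (rl_kernel a (t - u)) * (indicator {0..} u *\<^sub>R f u) \<partial>lborel)"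
proof -
  define g where "g = (\<lambda>u. of_real (rl_kernel a (t - u)) * (indicator {0..} u *\<^sub>R f u))"
  have [measurable]: "(\<lambda>u. indicator {0..} u *\<^sub>R f u) \<in> borel_measurable borel"
    using f by (intro borel_measurable_continuous_on_indicator) auto
  have gm[measurable]: "g \<in> borel_measurable borel" unfolding g_def by measurable
  have cpt: "compact (f ` {0..t})"
    using f by (intro compact_continuous_image) (auto intro: continuous_on_subset)
  then obtain B where B: "\<And>u. u \<in> {0..t} \<Longrightarrow> norm (f u) \<le> B"
    by (metis (no_types, lifting) bounded_iff compact_imp_bounded image_eqI)
  have B0: "B \<ge> 0" using order_trans[OF norm_ge_zero B[of 0]] t by simp
  \<comment> \<open>At \<open>v = t - u\<close> this function equals
    \<open>exp u * rl_kernel a (t - u)\<close>, which dominates the kernel because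
    \<open>exp u \<ge> 1\<close> for \<open>u \<ge> 0\<close>.\<close>
  have k1: "integrable lborel (\<lambda>v. exp t * (exp (- (1 * v)) * rl_kernel a v))"
    using rl_kernel_laplace_real(1)[OF a, of 1] by auto
  have int: "integrable lborel g"
  proof (rule Bochner_Integration.integrable_bound)
    show "integrable lborel (\<lambda>u. B * (exp t * (exp (- (1 * (t + (-1) * u))) * rl_kernel a (t + (-1) * u))))"
      using lborel_integrable_real_affine[OF k1, of "-1" t] by (intro integrable_mult_right) auto
    have "norm (g u) \<le> norm (B * (exp t * (exp (- (1 * (t + (-1) * u))) * rl_kernel a (t + (-1) * u))))" for u
    proof (cases "u \<ge> 0 \<and> u < t")
      case True
      have "norm (g u) = rl_kernel a (t - u) * norm (f u)"
        using True a by (simp add: g_def norm_mult rl_kernel_nonneg)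
      also have "\<dots> \<le> (exp u * rl_kernel a (t - u)) * B"
        using True a B0 by (intro mult_mono B) (auto simp: rl_kernel_nonneg intro!: mult_right_mono[of 1 "exp u", simplified])
      finally show ?thesis using B0 a by (simp add: rl_kernel_nonneg abs_mult exp_diff field_simps)
    qed (auto simp: g_def rl_kernel_def)
    then show "AE u in lborel. norm (g u) \<le> norm (B * (exp t * (exp (- (1 * (t + (-1) * u))) * rl_kernel a (t + (-1) * u))))"
      by simp
  qed (use gm in simp)
  then show "integrable lborel (\<lambda>u. of_real (rl_kernel a (t - u)) * (indicator {0..} u *\<^sub>R f u))"
    by (simp add: g_def)
  define I where "I = integral\<^sup>L lborel g"
  have "(g has_integral I) UNIV"
    unfolding I_def by (rule has_integral_integral_lborel[OF int])
  \<comment> \<open>At the endpoint \<open>u = t\<close> both sides vanish, because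
    \<open>0 powr (a - 1) = 0\<close>.\<close>
  also have "g = (\<lambda>u. if u \<in> {0..t} then (1 / Gamma a) *\<^sub>R ((t - u) powr (a - 1) *\<^sub>R f u) else 0)"
    by (auto simp: g_def rl_kernel_def fun_eq_iff scaleR_conv_of_real)
  finally have "((\<lambda>u. (1 / Gamma a) *\<^sub>R ((t - u) powr (a - 1) *\<^sub>R f u)) has_integral I) {0..t}"
    by (subst (asm) has_integral_restrict_UNIV) 
  then have "integral {0..t} (\<lambda>u. (1 / Gamma a) *\<^sub>R ((t - u) powr (a - 1) *\<^sub>R f u)) = I"
    by (rule integral_unique)
  then have "(1 / Gamma a) *\<^sub>R integral {0..t} (\<lambda>u. (t - u) powr (a - 1) *\<^sub>R f u) = I"
    by (simp only: integral_cmul)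
  then show "rl_integral a f t = (\<integral>u. of_real (rl_kernel a (t - u)) * (indicator {0..} u *\<^sub>R f u) \<partial>lborel)"
    by (simp add: rl_integral_def I_def g_def)
qed

section \<open>Fourier inversion\<close>

text \<open>This is the characteristic function of the normal distribution at \<open>v / e\<close>,
  rescaled by \<open>z = e * w\<close>. Writing the result through \<open>std_normal_density\<close>
  lets it act as an averaging kernel later.\<close>

lemma fourier_gaussian:
  fixes e v :: real
  assumes e: "e > 0"
  shows "integrable lborel (\<lambda>w. std_normal_density (e * w))"
    and "(\<integral>w. std_normal_density (e * w) *\<^sub>R iexp (w * v) \<partial>lborel)
           = of_real (sqrt (2 * pi) / e * std_normal_density (v / e))"
proof -
  have [measurable]: "std_normal_density \<in> borel_measurable borel" by simp
  have I: "integrable lborel std_normal_density" by (rule integrable_normal_density) simp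
  show "integrable lborel (\<lambda>w. std_normal_density (e * w))"
    using lborel_integrable_real_affine[OF I, of e 0] e by simp
  have "char std_normal_distribution (v / e) = (\<integral>z. std_normal_density z *\<^sub>R iexp ((v / e) * z) \<partial>lborel)"
    unfolding char_def by (subst integral_density) auto
  also have "\<dots> = e *\<^sub>R (\<integral>w. std_normal_density (e * w) *\<^sub>R iexp (w * v) \<partial>lborel)"
    using e by (subst lborel_integral_real_affine[of e _ 0]) (auto simp: field_simps)
  finally have "e *\<^sub>R (\<integral>w. std_normal_density (e * w) *\<^sub>R iexp (w * v) \<partial>lborel)
     = of_real (exp (- (v / e)\<^sup>2 / 2))"
    by (simp add: char_std_normal_distribution)
  also have "exp (- (v / e)\<^sup>2 / 2) = sqrt (2 * pi) * std_normal_density (v / e)"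
    by (simp add: std_normal_density_def)
  finally show "(\<integral>w. std_normal_density (e * w) *\<^sub>R iexp (w * v) \<partial>lborel)
           = of_real (sqrt (2 * pi) / e * std_normal_density (v / e))"
    using e by (simp add: scaleR_conv_of_real field_simps)
qed

text \<open>The Gaussian factor makes the double integral absolutely convergent even if the
  transform of \<open>g\<close> is not integrable, so Fubini applies. What remains is a Gaussian
  average of \<open>g\<close> around \<open>t\<close> at scale \<open>e\<close>.\<close>

lemma fourier_gauss_weierstrass:
  fixes g :: "real \<Rightarrow> complex"
  assumes g: "integrable lborel g" and e: "e > 0"
  shows "(\<integral>w. std_normal_density (e * w) *\<^sub>R (iexp (w * t) * (\<integral>u. iexp (- (w * u)) * g u \<partial>lborel)) \<partial>lborel)
       = sqrt (2 * pi) *\<^sub>R (\<integral>z. std_normal_density z *\<^sub>R g (t - e * z) \<partial>lborel)"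
proof -
  have [measurable]: "g \<in> borel_measurable borel"
    using g borel_measurable_integrable by force
  define F where "F = (\<lambda>(w, u). (std_normal_density (e * w) *\<^sub>R iexp (w * (t - u))) * g u)"
  have nF: "norm (F (w, u)) = std_normal_density (e * w) * norm (g u)" for w u
    by (simp add: F_def norm_mult)
  have I: "integrable (lborel \<Otimes>\<^sub>M lborel) F"
  proof (rule lborel_pair.Fubini_integrable)
    show "F \<in> borel_measurable (lborel \<Otimes>\<^sub>M lborel)"
      unfolding F_def by measurable
    show "integrable lborel (\<lambda>w. \<integral>u. norm (F (w, u)) \<partial>lborel)"
      using fourier_gaussian(1)[OF e] by (simp add: nF)
    have "integrable lborel (\<lambda>u. F (w, u))" for w
    proof (rule Bochner_Integration.integrable_bound)
      show "integrable lborel (\<lambda>u. std_normal_density (e * w) * norm (g u))"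
        using g by simp
      show "(\<lambda>u. F (w, u)) \<in> borel_measurable lborel"
        unfolding F_def by simp
    qed (simp add: nF)
    then show "AE w in lborel. integrable lborel (\<lambda>u. F (w, u))" by simp
  qed
  have "(\<integral>w. std_normal_density (e * w) *\<^sub>R (iexp (w * t) * (\<integral>u. iexp (- (w * u)) * g u \<partial>lborel)) \<partial>lborel)
      = (\<integral>w. (\<integral>u. F (w, u) \<partial>lborel) \<partial>lborel)"
  proof (rule Bochner_Integration.integral_cong)
    fix w :: real
    have "F (w, u) = (std_normal_density (e * w) *\<^sub>R iexp (w * t)) * (iexp (- (w * u)) * g u)" for u
      by (simp add: F_def algebra_simps exp_diff exp_minus divide_inverse)
    then show "std_normal_density (e * w) *\<^sub>R (iexp (w * t) * (\<integral>u. iexp (- (w * u)) * g u \<partial>lborel))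
      = (\<integral>u. F (w, u) \<partial>lborel)" by simp
  qed simp
  also have "\<dots> = (\<integral>u. (\<integral>w. F (w, u) \<partial>lborel) \<partial>lborel)"
    using lborel_pair.Fubini_integral[of "\<lambda>w u. F (w, u)"] I by simp
  also have "\<dots> = (\<integral>u. of_real (sqrt (2 * pi) / e * std_normal_density ((t - u) / e)) * g u \<partial>lborel)"
  proof -
    have "(\<integral>w. F (w, u) \<partial>lborel) = (\<integral>w. std_normal_density (e * w) *\<^sub>R iexp (w * (t - u)) \<partial>lborel) * g u" for u
      unfolding F_def prod.case by (rule integral_mult_left_zero)
    then show ?thesis by (simp only: fourier_gaussian(2)[OF e])
  qed
  \<comment> \<open>Substitution \<open>u = t - e * z\<close>; its Jacobian cancels the factor
    \<open>1 / e\<close> in the next step.\<close>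
  also have "\<dots> = \<bar>-e\<bar> *\<^sub>R (\<integral>z. of_real (sqrt (2 * pi) / e * std_normal_density z) * g (t - e * z) \<partial>lborel)"
    using e by (subst lborel_integral_real_affine[of "-e" _ t]) auto
  also have "\<dots> = sqrt (2 * pi) *\<^sub>R (\<integral>z. std_normal_density z *\<^sub>R g (t - e * z) \<partial>lborel)"
  proof -
    have "of_real (sqrt (2 * pi) / e * std_normal_density z) * g (t - e * z)
      = (sqrt (2 * pi) / e) *\<^sub>R (std_normal_density z *\<^sub>R g (t - e * z))" for z
      by (simp add: scaleR_conv_of_real)
    then show ?thesis using e by (simp only: integral_scaleR_right) simp
  qed
  finally show ?thesis .
qed

text \<open>Let the scale in \<open>fourier_gauss_weierstrass\<close> tend to \<open>0\<close>. On
  one side the integrable transform dominates and the damping tends to the constant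
  \<open>1 / sqrt (2 * pi)\<close>; on the other, \<open>g\<close> is bounded and continuous at
  \<open>t\<close>, so its averages tend to \<open>g t\<close>.\<close>

theorem fourier_inversion:
  fixes g :: "real \<Rightarrow> complex"
  assumes g: "integrable lborel g" and cont: "isCont g t" and bnd: "\<And>u. norm (g u) \<le> B"
    and G: "integrable lborel (\<lambda>w. \<integral>u. iexp (- (w * u)) * g u \<partial>lborel)"
  shows "(\<integral>w. iexp (w * t) * (\<integral>u. iexp (- (w * u)) * g u \<partial>lborel) \<partial>lborel) = of_real (2 * pi) * g t"
proof -
  define H where "H = (\<lambda>w. iexp (w * t) * (\<integral>u. iexp (- (w * u)) * g u \<partial>lborel))"
  define e :: "nat \<Rightarrow> real" where "e = (\<lambda>n. inverse (real (Suc n)))"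
  have e: "e n > 0" "e \<longlonglongrightarrow> 0" for n
    unfolding e_def using LIMSEQ_inverse_real_of_nat by auto
  have I: "integrable lborel std_normal_density" by (rule integrable_normal_density) simp
  have [measurable]: "g \<in> borel_measurable borel"
    using g borel_measurable_integrable by force
  have Gm[measurable]: "(\<lambda>w. \<integral>u. iexp (- (w * u)) * g u \<partial>lborel) \<in> borel_measurable borel"
    using G borel_measurable_integrable by force
  have cont_nd: "isCont std_normal_density z" for z
    unfolding std_normal_density_def by (intro continuous_intros) auto
  have nd_le: "std_normal_density z \<le> 1 / sqrt (2 * pi)" for z
    unfolding std_normal_density_def by (simp add: divide_right_mono)
  have "(\<lambda>n. \<integral>w. std_normal_density (e n * w) *\<^sub>R H w \<partial>lborel) \<longlonglongrightarrow> (\<integral>w. (1 / sqrt (2 * pi)) *\<^sub>R H w \<partial>lborel)"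
  proof (rule integral_dominated_convergence)
    have Hm[measurable]: "H \<in> borel_measurable borel" unfolding H_def by measurable
    show "(\<lambda>w. (1 / sqrt (2 * pi)) *\<^sub>R H w) \<in> borel_measurable lborel"
      "\<And>n. (\<lambda>w. std_normal_density (e n * w) *\<^sub>R H w) \<in> borel_measurable lborel" by measurable
    show "integrable lborel (\<lambda>w. (1 / sqrt (2 * pi)) * norm (\<integral>u. iexp (- (w * u)) * g u \<partial>lborel))"
      using G by (intro integrable_mult_right integrable_norm)
    have "(\<lambda>n. std_normal_density (e n * w) *\<^sub>R H w) \<longlonglongrightarrow> std_normal_density 0 *\<^sub>R H w" for w
    proof (intro tendsto_intros isCont_tendsto_compose[OF cont_nd])
      show "(\<lambda>n. e n * w) \<longlonglongrightarrow> 0" using tendsto_mult_left[OF e(2), of w] by (simp add: mult.commute)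
    qed
    then show "AE w in lborel. (\<lambda>n. std_normal_density (e n * w) *\<^sub>R H w) \<longlonglongrightarrow> (1 / sqrt (2 * pi)) *\<^sub>R H w"
      by (simp add: std_normal_density_def)
    show "AE w in lborel. norm (std_normal_density (e n * w) *\<^sub>R H w) \<le> (1 / sqrt (2 * pi)) * norm (\<integral>u. iexp (- (w * u)) * g u \<partial>lborel)" for n
      using mult_right_mono[OF nd_le norm_ge_zero[where 'a = complex]] by (simp add: H_def norm_mult)
  qed
  then have lim1: "(\<lambda>n. sqrt (2 * pi) *\<^sub>R (\<integral>z. std_normal_density z *\<^sub>R g (t - e n * z) \<partial>lborel)) \<longlonglongrightarrow> (1 / sqrt (2 * pi)) *\<^sub>R (\<integral>w. H w \<partial>lborel)"
    using fourier_gauss_weierstrass[OF g e(1), where t = t] by (simp add: H_def)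
  have "(\<lambda>n. \<integral>z. std_normal_density z *\<^sub>R g (t - e n * z) \<partial>lborel) \<longlonglongrightarrow> (\<integral>z. std_normal_density z *\<^sub>R g t \<partial>lborel)"
  proof (rule integral_dominated_convergence)
    show "integrable lborel (\<lambda>z. std_normal_density z * B)" using I by simp
    have "(\<lambda>n. std_normal_density z *\<^sub>R g (t - e n * z)) \<longlonglongrightarrow> std_normal_density z *\<^sub>R g t" for z
    proof (intro tendsto_intros isCont_tendsto_compose[OF cont])
      show "(\<lambda>n. t - e n * z) \<longlonglongrightarrow> t" using tendsto_diff[OF tendsto_const tendsto_mult_right[OF e(2), of z], of t] by simp
    qed
    then show "AE z in lborel. (\<lambda>n. std_normal_density z *\<^sub>R g (t - e n * z)) \<longlonglongrightarrow> std_normal_density z *\<^sub>R g t"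
      by simp
    show "AE z in lborel. norm (std_normal_density z *\<^sub>R g (t - e n * z)) \<le> std_normal_density z * B" for n
      using bnd by (auto intro!: mult_left_mono)
  qed auto
  also have "(\<integral>z. std_normal_density z *\<^sub>R g t \<partial>lborel) = g t"
    using I by simp
  finally have lim2: "(\<lambda>n. sqrt (2 * pi) *\<^sub>R (\<integral>z. std_normal_density z *\<^sub>R g (t - e n * z) \<partial>lborel)) \<longlonglongrightarrow> sqrt (2 * pi) *\<^sub>R g t"
    by (intro tendsto_intros)
  have "(1 / sqrt (2 * pi)) *\<^sub>R (\<integral>w. H w \<partial>lborel) = sqrt (2 * pi) *\<^sub>R g t"
    by (rule LIMSEQ_unique[OF lim1 lim2])
  then have "sqrt (2 * pi) *\<^sub>R (1 / sqrt (2 * pi)) *\<^sub>R (\<integral>w. H w \<partial>lborel) = (sqrt (2 * pi) * sqrt (2 * pi)) *\<^sub>R g t"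
    by simp
  then show ?thesis by (simp add: H_def scaleR_conv_of_real)
qed

section \<open>Integrals along vertical lines\<close>

lemma integrable_powr_vertical_unit:
  fixes a :: real
  assumes a: "a < 1"
  shows "integrable lborel (\<lambda>w. norm (Complex 1 w) powr (a - 2))"
proof -
  \<comment> \<open>Tail majorant, integrable because \<open>a - 2 < -1\<close>. Together with its
    mirror image and the indicator of \<open>{-1..1}\<close> it dominates the integrand.\<close>
  define p where "p = (\<lambda>x::real. indicator {1..} x * x powr (a - 2))"
  have pm[measurable]: "p \<in> borel_measurable borel" unfolding p_def by measurable
  have "(\<integral>\<^sup>+x. ennreal (p x) \<partial>lborel) = ennreal (- (1 powr (a - 2 + 1)) / (a - 2 + 1))"
    unfolding p_def using a
    by (intro nn_integral_has_integral_lebesgue has_integral_powr_to_inf) auto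
  then have p: "integrable lborel p"
    by (intro integrableI_nonneg) (auto simp: p_def)
  have p': "integrable lborel (\<lambda>x. p (0 + (-1) * x))"
    by (rule lborel_integrable_real_affine[OF p]) simp
  have i: "integrable lborel (\<lambda>x::real. indicator {-1..1} x :: real)"
    by (simp add: integrable_indicator_iff)
  show ?thesis
  proof (rule Bochner_Integration.integrable_bound)
    show "integrable lborel (\<lambda>x. indicator {-1..1} x + (p x + p (0 + (-1) * x)))"
      by (intro Bochner_Integration.integrable_add i p p')
    have "norm (Complex 1 w) powr (a - 2) \<le> indicator {-1..1} w + (p w + p (0 + (-1) * w))" for w
    proof (cases "\<bar>w\<bar> \<le> 1")
      case True
      have "1 \<le> norm (Complex 1 w)" using abs_Re_le_cmod[of "Complex 1 w"] by simp
      then have "norm (Complex 1 w) powr (a - 2) \<le> 1 powr (a - 2)"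
        using a by (intro powr_mono2') auto
      with True show ?thesis by (auto simp: p_def indicator_def abs_le_iff)
    next
      case False
      have "\<bar>w\<bar> \<le> norm (Complex 1 w)" using abs_Im_le_cmod[of "Complex 1 w"] by simp
      then have "norm (Complex 1 w) powr (a - 2) \<le> \<bar>w\<bar> powr (a - 2)"
        using a False by (intro powr_mono2') auto
      with False show ?thesis by (auto simp: p_def indicator_def split: if_splits)
    qed
    then show "AE w in lborel. norm (norm (Complex 1 w) powr (a - 2)) \<le> norm (indicator {-1..1} w + (p w + p (0 + (-1) * w)))"
      by (intro AE_I2) (smt (verit) powr_ge_zero real_norm_def)
  qed (simp add: cmod_def)
qed

text \<open>Scaling \<open>w\<close> by \<open>c\<close> reduces the line at \<open>c\<close> to the
  line at \<open>1\<close>. The factor \<open>c powr (a - 1)\<close> decides the decay rate once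
  \<open>c = 1 / t\<close> is chosen.\<close>

lemma vertical_line_powr:
  fixes a c :: real
  assumes a: "a < 1" and c: "c > 0"
  shows "integrable lborel (\<lambda>w. norm (Complex c w) powr (a - 2))"
    and "(\<integral>w. norm (Complex c w) powr (a - 2) \<partial>lborel)
      = c powr (a - 1) * (\<integral>w. norm (Complex 1 w) powr (a - 2) \<partial>lborel)"
proof -
  have *: "norm (Complex c (0 + c * w)) powr (a - 2) = c powr (a - 2) * norm (Complex 1 w) powr (a - 2)" for w
  proof -
    have "Complex c (0 + c * w) = of_real c * Complex 1 w" by (simp add: complex_eq_iff)
    then have "norm (Complex c (0 + c * w)) = c * norm (Complex 1 w)"
      using c by (simp only: norm_mult norm_of_real)
    then show ?thesis using c by (simp add: powr_mult)
  qed
  show "integrable lborel (\<lambda>w. norm (Complex c w) powr (a - 2))"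
    using integrable_powr_vertical_unit[OF a] c
    by (subst lborel_integrable_real_affine_iff[symmetric, of c _ 0]) (auto simp: * simp del: add_0)
  have "(\<integral>w. norm (Complex c w) powr (a - 2) \<partial>lborel) = c * (c powr (a - 2) * (\<integral>w. norm (Complex 1 w) powr (a - 2) \<partial>lborel))"
    using c by (subst lborel_integral_real_affine[of c _ 0]) (auto simp: * simp del: add_0)
  also have "c * (c powr (a - 2) * (\<integral>w. norm (Complex 1 w) powr (a - 2) \<partial>lborel)) = c powr (a - 1) * (\<integral>w. norm (Complex 1 w) powr (a - 2) \<partial>lborel)"
    using c powr_mult_base[of c "a - 2"] by (simp add: algebra_simps)
  finally show "(\<integral>w. norm (Complex c w) powr (a - 2) \<partial>lborel)
      = c powr (a - 1) * (\<integral>w. norm (Complex 1 w) powr (a - 2) \<partial>lborel)" .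
qed

lemma vertical_line_integrable:
  fixes F :: "complex \<Rightarrow> complex"
  assumes hol: "F holomorphic_on {s. Re s > 0}"
    and bnd: "\<And>s. Re s > 0 \<Longrightarrow> norm (F s) \<le> C * norm s powr (a - 2)"
    and a: "a < 1" and c: "c > 0"
  shows "integrable lborel (\<lambda>w. exp (t *\<^sub>R Complex c w) * F (Complex c w))"
    and "norm (\<integral>w. exp (t *\<^sub>R Complex c w) * F (Complex c w) \<partial>lborel)
      \<le> exp (t * c) * (C * (c powr (a - 1) * (\<integral>w. norm (Complex 1 w) powr (a - 2) \<partial>lborel)))"
proof -
  have "continuous_on UNIV (\<lambda>w. F (Complex c w))"
    by (rule continuous_on_compose2[OF holomorphic_on_imp_continuous_on[OF hol]])
      (use c in \<open>auto intro!: continuous_intros simp: Complex_eq\<close>)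
  then have [measurable]: "(\<lambda>w. F (Complex c w)) \<in> borel_measurable borel"
    by (rule borel_measurable_continuous_onI)
  have "continuous_on UNIV (\<lambda>w. exp (t *\<^sub>R Complex c w))"
    by (auto intro!: continuous_intros simp: Complex_eq)
  then have [measurable]: "(\<lambda>w. exp (t *\<^sub>R Complex c w)) \<in> borel_measurable borel"
    by (rule borel_measurable_continuous_onI)
  have le: "norm (exp (t *\<^sub>R Complex c w) * F (Complex c w)) \<le> exp (t * c) * (C * norm (Complex c w) powr (a - 2))" for w
    using bnd[of "Complex c w"] c by (simp add: norm_mult)
  have int: "integrable lborel (\<lambda>w. exp (t * c) * (C * norm (Complex c w) powr (a - 2)))"
    using vertical_line_powr(1)[OF a c] by (intro integrable_mult_right)
  show I: "integrable lborel (\<lambda>w. exp (t *\<^sub>R Complex c w) * F (Complex c w))"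
  proof (rule Bochner_Integration.integrable_bound[OF int])
    show "AE w in lborel. norm (exp (t *\<^sub>R Complex c w) * F (Complex c w)) \<le> norm (exp (t * c) * (C * norm (Complex c w) powr (a - 2)))"
      using le by (intro AE_I2) (metis abs_ge_self order_trans real_norm_def)
  qed measurable
  have "norm (\<integral>w. exp (t *\<^sub>R Complex c w) * F (Complex c w) \<partial>lborel) \<le> (\<integral>w. norm (exp (t *\<^sub>R Complex c w) * F (Complex c w)) \<partial>lborel)"
    by (rule integral_norm_bound)
  also have "\<dots> \<le> (\<integral>w. exp (t * c) * (C * norm (Complex c w) powr (a - 2)) \<partial>lborel)"
    using I int le by (intro integral_mono integrable_norm)
  also have "\<dots> = exp (t * c) * (C * (c powr (a - 1) * (\<integral>w. norm (Complex 1 w) powr (a - 2) \<partial>lborel)))"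
    using vertical_line_powr(2)[OF a c] by simp
  finally show "norm (\<integral>w. exp (t *\<^sub>R Complex c w) * F (Complex c w) \<partial>lborel)
      \<le> exp (t * c) * (C * (c powr (a - 1) * (\<integral>w. norm (Complex 1 w) powr (a - 2) \<partial>lborel)))" .
qed

text \<open>The fundamental theorem of calculus on a vertical segment; \<open>\<i>\<close> is the
  velocity of the parametrization. The truncation is written as an indicator so that
  \<open>r\<close> can later grow under dominated convergence.\<close>

lemma vertical_line_primitive:
  fixes H h :: "complex \<Rightarrow> complex"
  assumes H: "\<And>s. Re s > 0 \<Longrightarrow> (H has_field_derivative h s) (at s)"
    and c: "c > 0" and r: "r \<ge> 0" and int: "integrable lborel (\<lambda>w. h (Complex c w))"
  shows "\<i> * (\<integral>w. indicator {-r..r} w *\<^sub>R h (Complex c w) \<partial>lborel) = H (Complex c r) - H (Complex c (-r))"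
proof -
  have "((\<lambda>w. \<i> * h (Complex c w)) has_integral (H (Complex c r) - H (Complex c (-r)))) {-r..r}"
  proof (rule fundamental_theorem_of_calculus)
    fix w
    have "((\<lambda>w. Complex c w) has_vector_derivative \<i>) (at w within {-r..r})"
      unfolding Complex_eq by (auto intro!: derivative_eq_intros simp: has_vector_derivative_def scaleR_conv_of_real)
    moreover have "(H has_field_derivative h (Complex c w)) (at (Complex c w))" using c by (intro H) simp
    ultimately show "((\<lambda>w. H (Complex c w)) has_vector_derivative \<i> * h (Complex c w)) (at w within {-r..r})"
      using field_vector_diff_chain_within[of "\<lambda>w. Complex c w" \<i> w "{-r..r}" H "h (Complex c w)"]
      by (simp add: o_def has_field_derivative_at_within)
  qed (use r in auto)
  then have "integral {-r..r} (\<lambda>w. \<i> * h (Complex c w)) = H (Complex c r) - H (Complex c (-r))"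
    by (rule integral_unique)
  moreover have "set_integrable lborel {-r..r} (\<lambda>w. h (Complex c w))"
    unfolding set_integrable_def by (rule integrable_mult_indicator[OF _ int]) simp
  from set_borel_integral_eq_integral[OF this]
  have "(\<integral>w. indicator {-r..r} w *\<^sub>R h (Complex c w) \<partial>lborel) = integral {-r..r} (\<lambda>w. h (Complex c w))"
    by (simp add: set_lebesgue_integral_def)
  ultimately show ?thesis by simp
qed

text \<open>On the convex half-plane the integrand has a primitive \<open>H\<close>. The truncated
  integrals over the two lines differ only by the increments of \<open>H\<close> along the
  horizontal sides at heights \<open>n\<close> and \<open>-n\<close>, and the bound on
  \<open>F\<close> makes these vanish as \<open>n\<close> grows.\<close>

lemma contour_shift:
  fixes F :: "complex \<Rightarrow> complex"
  assumes hol: "F holomorphic_on {s. Re s > 0}"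
    and bnd: "\<And>s. Re s > 0 \<Longrightarrow> norm (F s) \<le> C * norm s powr (a - 2)"
    and a: "a < 1" and b: "0 < b" and bc: "b \<le> c" and t: "t \<ge> 0"
  shows "(\<integral>w. exp (t *\<^sub>R Complex b w) * F (Complex b w) \<partial>lborel) = (\<integral>w. exp (t *\<^sub>R Complex c w) * F (Complex c w) \<partial>lborel)"
proof -
  define h where "h = (\<lambda>s. exp (t *\<^sub>R s) * F s)"
  have S: "open {s. Re s > 0}" "convex {s. Re s > 0}"
    by (auto simp: open_halfspace_Re_gt convex_halfspace_Re_gt)
  have "h holomorphic_on {s. Re s > 0}"
    unfolding h_def scaleR_conv_of_real by (intro holomorphic_intros hol)
  from holomorphic_convex_primitive'[OF S(2,1) this] obtain H where
    H': "\<And>s. s \<in> {s. Re s > 0} \<Longrightarrow> (H has_field_derivative h s) (at s within {s. Re s > 0})" by blast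
  have H: "(H has_field_derivative h s) (at s)" if "Re s > 0" for s
    using H'[of s] that S(1) at_within_open[of s "{s. Re s > 0}"] by auto
  have C: "C \<ge> 0"
    using order_trans[OF norm_ge_zero bnd[of 1]] by simp
  have int: "integrable lborel (\<lambda>w. h (Complex x w))" if "x > 0" for x
    using vertical_line_integrable(1)[OF hol bnd a that] by (simp add: h_def)
  define L where "L = (\<lambda>x (n::nat). \<integral>w. indicator {- real n..real n} w *\<^sub>R h (Complex x w) \<partial>lborel)"
  have L_lim: "L x \<longlonglongrightarrow> (\<integral>w. h (Complex x w) \<partial>lborel)" if "x > 0" for x
    unfolding L_def
  proof (rule integral_dominated_convergence)
    note [measurable] = borel_measurable_integrable[OF int[OF that]]
    show "(\<lambda>w. h (Complex x w)) \<in> borel_measurable lborel" by measurable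
    show "(\<lambda>w. indicator {- real n..real n} w *\<^sub>R h (Complex x w)) \<in> borel_measurable lborel" for n
      by measurable
    show "integrable lborel (\<lambda>w. norm (h (Complex x w)))" using int[OF that] by (rule integrable_norm)
    have "(\<lambda>n. indicator {- real n..real n} w *\<^sub>R h (Complex x w)) \<longlonglongrightarrow> h (Complex x w)" for w
    proof (rule tendsto_eventually)
      obtain N :: nat where N: "\<bar>w\<bar> \<le> real N" using real_arch_simple by blast
      show "eventually (\<lambda>n. indicator {- real n..real n} w *\<^sub>R h (Complex x w) = h (Complex x w)) sequentially"
        using eventually_ge_at_top[of N] by eventually_elim (use N in \<open>auto simp: indicator_def\<close>)
    qed
    then show "AE w in lborel. (\<lambda>n. indicator {- real n..real n} w *\<^sub>R h (Complex x w)) \<longlonglongrightarrow> h (Complex x w)" by simp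
    show "AE w in lborel. norm (indicator {- real n..real n} w *\<^sub>R h (Complex x w)) \<le> norm (h (Complex x w))" for n
      by (auto simp: indicator_def)
  qed
  \<comment> \<open>Mean value inequality on a horizontal side: there
    \<open>norm s \<ge> \<bar>y\<bar>\<close>, the exponent \<open>a - 2\<close> is negative, and
    the exponential is largest at the right end \<open>c\<close>.\<close>
  have H_diff: "norm (H (Complex b y) - H (Complex c y)) \<le> exp (t * c) * (C * \<bar>y\<bar> powr (a - 2)) * (c - b)" if "y \<noteq> 0" for y
  proof -
    have "norm (H (Complex b y) - H (Complex c y)) \<le> exp (t * c) * (C * \<bar>y\<bar> powr (a - 2)) * norm (Complex b y - Complex c y)"
    proof (rule field_differentiable_bound[where f = H and f' = h and S = "{s. b \<le> Re s \<and> Re s \<le> c \<and> Im s = y}"])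
      have "convex ({s. Re s \<ge> b} \<inter> {s. Re s \<le> c} \<inter> {s. Im s \<ge> y} \<inter> {s. Im s \<le> y})"
        by (intro convex_Int convex_halfspace_Re_ge convex_halfspace_Re_le convex_halfspace_Im_ge convex_halfspace_Im_le)
      also have "{s. Re s \<ge> b} \<inter> {s. Re s \<le> c} \<inter> {s. Im s \<ge> y} \<inter> {s. Im s \<le> y} = {s. b \<le> Re s \<and> Re s \<le> c \<and> Im s = y}"
        by auto
      finally show "convex {s. b \<le> Re s \<and> Re s \<le> c \<and> Im s = y}" .
      fix z assume z: "z \<in> {s. b \<le> Re s \<and> Re s \<le> c \<and> Im s = y}"
      then show "(H has_field_derivative h z) (at z within {s. b \<le> Re s \<and> Re s \<le> c \<and> Im s = y})"
        using b by (intro has_field_derivative_at_within[OF H]) auto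
      have "norm (h z) = exp (t * Re z) * norm (F z)" by (simp add: h_def norm_mult)
      also have "\<dots> \<le> exp (t * c) * (C * norm z powr (a - 2))"
        using z t b by (intro mult_mono bnd) (auto intro: mult_left_mono)
      also have "\<dots> \<le> exp (t * c) * (C * \<bar>y\<bar> powr (a - 2))"
        using z abs_Im_le_cmod[of z] that a C by (intro mult_left_mono powr_mono2') auto
      finally show "norm (h z) \<le> exp (t * c) * (C * \<bar>y\<bar> powr (a - 2))" .
    qed (use bc in auto)
    also have "Complex b y - Complex c y = of_real (b - c)" by (simp add: complex_eq_iff)
    finally show ?thesis using bc by (simp only: norm_of_real) simp
  qed
  have "(\<lambda>n. L b n - L c n) \<longlonglongrightarrow> 0"
  proof (rule Lim_null_comparison)
    show "(\<lambda>n. 2 * (exp (t * c) * (C * real n powr (a - 2)) * (c - b))) \<longlonglongrightarrow> 0"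
      using a by (intro tendsto_mult_right_zero tendsto_mult_left_zero tendsto_neg_powr filterlim_real_sequentially) simp
    show "eventually (\<lambda>n. norm (L b n - L c n) \<le> 2 * (exp (t * c) * (C * real n powr (a - 2)) * (c - b))) sequentially"
      using eventually_gt_at_top[of 0]
    proof eventually_elim
      case (elim n)
      have "\<i> * (L b n - L c n) = (H (Complex b n) - H (Complex c n)) - (H (Complex b (-n)) - H (Complex c (-n)))"
        unfolding L_def right_diff_distrib
        using vertical_line_primitive[OF H b _ int[OF b], of n] vertical_line_primitive[OF H _ _ int, of c n] b bc by simp
      then have "norm (L b n - L c n) = norm \<dots>"
        by (metis mult.left_neutral norm_ii norm_mult)
      also have "\<dots> \<le> norm (H (Complex b n) - H (Complex c n)) + norm (H (Complex b (-n)) - H (Complex c (-n)))"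
        by (rule norm_triangle_ineq4)
      also have "\<dots> \<le> 2 * (exp (t * c) * (C * real n powr (a - 2)) * (c - b))"
        using H_diff[of n] H_diff[of "-n"] elim by simp
      finally show ?case .
    qed
  qed
  moreover have "(\<lambda>n. L b n - L c n) \<longlonglongrightarrow> (\<integral>w. h (Complex b w) \<partial>lborel) - (\<integral>w. h (Complex c w) \<partial>lborel)"
    using b bc by (intro tendsto_diff L_lim) auto
  ultimately have "(\<integral>w. h (Complex b w) \<partial>lborel) - (\<integral>w. h (Complex c w) \<partial>lborel) = 0"
    using LIMSEQ_unique by blast
  then show ?thesis by (simp add: h_def)
qed

section \<open>The resolvent on the right half-plane\<close>

lemma char_matrix_mult_vec:
  "(char_matrix \<alpha> A s *v v) $ i = s powr of_real (\<alpha> i) * v $ i - (\<Sum>j\<in>UNIV. A $ i $ j * v $ j)"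
proof -
  have "(char_matrix \<alpha> A s *v v) $ i = (\<Sum>j\<in>UNIV. (if i = j then s powr of_real (\<alpha> i) * v $ j else 0) - A $ i $ j * v $ j)"
    unfolding char_matrix_def matrix_vector_mult_def
    by (auto simp: left_diff_distrib intro!: sum.cong)
  then show ?thesis by (simp add: sum_subtractf)
qed

lemma sum_norm_matrix_le:
  fixes A :: "complex^'d::finite^'e::finite"
  shows "(\<Sum>i\<in>UNIV. norm (\<Sum>j\<in>UNIV. A $ i $ j * v $ j))
    \<le> (\<Sum>i\<in>UNIV. \<Sum>j\<in>UNIV. norm (A $ i $ j)) * (\<Sum>j\<in>UNIV. norm (v $ j))"
proof -
  have "norm (\<Sum>j\<in>UNIV. A $ i $ j * v $ j) \<le> (\<Sum>j\<in>UNIV. norm (A $ i $ j)) * (\<Sum>j\<in>UNIV. norm (v $ j))" for i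
  proof -
    have "norm (\<Sum>j\<in>UNIV. A $ i $ j * v $ j) \<le> (\<Sum>j\<in>UNIV. norm (A $ i $ j) * norm (v $ j))"
      by (rule order_trans[OF norm_sum]) (simp add: norm_mult)
    also have "\<dots> \<le> (\<Sum>j\<in>UNIV. norm (A $ i $ j) * (\<Sum>j\<in>UNIV. norm (v $ j)))"
      by (intro sum_mono mult_left_mono member_le_sum) auto
    finally show ?thesis by (simp add: sum_distrib_right)
  qed
  then show ?thesis by (simp add: sum_distrib_right sum_mono)
qed

text \<open>The witness is chosen so that its power \<open>- a\<close> is exactly
  \<open>1 / (2 * S + 1)\<close>. It serves two absorption arguments: for the resolvent at large
  \<open>s\<close> and for the growth of solutions.\<close>

lemma ex_powr_minus_le_half:
  fixes a S :: real
  assumes "a > 0" "S \<ge> 0"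
  shows "\<exists>R\<ge>1. \<forall>r\<ge>R. r powr (- a) * S \<le> 1 / 2"
proof (intro exI[of _ "(2 * S + 1) powr (1 / a)"] conjI allI impI)
  show R: "(2 * S + 1) powr (1 / a) \<ge> 1" using assms by (intro ge_one_powr_ge_zero) auto
  fix r assume r: "r \<ge> (2 * S + 1) powr (1 / a)"
  have "r powr (- a) * S \<le> ((2 * S + 1) powr (1 / a)) powr (- a) * S"
    using r R assms by (intro mult_right_mono powr_mono2') auto
  also have "\<dots> = S / (2 * S + 1)"
    using assms by (simp add: powr_powr powr_minus divide_inverse)
  also have "\<dots> \<le> 1 / 2" using assms by (simp add: field_simps)
  finally show "r powr (- a) * S \<le> 1 / 2" .
qed

text \<open>The product is the minimum of \<open>r powr p\<close> and \<open>1\<close>. The first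
  bounds it for \<open>r \<le> 1\<close>, the second for \<open>r > 1\<close>. Thus powers with
  different exponents \<open>p\<close> are reduced to one common exponent \<open>b\<close>.\<close>

lemma min_powr_le:
  fixes r b p :: real
  assumes "r > 0" "0 \<le> b" "b \<le> p"
  shows "min 1 (r powr (- p)) * r powr p \<le> r powr b"
proof -
  have "min 1 (r powr (- p)) * r powr p = min (r powr p) 1"
    using assms by (simp add: min_def powr_minus field_simps)
  also have "\<dots> \<le> r powr b"
  proof (cases "r \<le> 1")
    case True
    then have "r powr p \<le> r powr b" using assms by (intro powr_mono') auto
    then show ?thesis by simp
  next
    case False
    then have "1 \<le> r powr b" using assms by (intro ge_one_powr_ge_zero) auto
    then show ?thesis by simp
  qed
  finally show ?thesis .
qed

text \<open>The closed half-plane meets the branch cut of the principal power only at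
  \<open>0\<close>, and there a positive exponent makes the power continuous with value
  \<open>0\<close>.\<close>

lemma continuous_on_char_matrix_mult_vec:
  fixes A :: "complex^'d::finite^'d"
  assumes "\<And>i. \<alpha> i > 0"
  shows "continuous_on ({s. Re s \<ge> 0} \<times> UNIV) (\<lambda>(s, v). char_matrix \<alpha> A s *v v)"
proof -
  have eq: "(\<lambda>(s, v). char_matrix \<alpha> A s *v v)
      = (\<lambda>p. \<chi> i. fst p powr of_real (\<alpha> i) * snd p $ i - (\<Sum>j\<in>UNIV. A $ i $ j * snd p $ j))"
    by (auto simp: fun_eq_iff vec_eq_iff char_matrix_mult_vec)
  show ?thesis
    unfolding eq using assms by (intro continuous_intros) auto
qed

lemma resolvent_unique:
  fixes A :: "complex^'d::finite^'d"
  assumes "det (char_matrix \<alpha> A s) \<noteq> 0" "char_matrix \<alpha> A s *v v = char_matrix \<alpha> A s *v v'"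
  shows "v = v'"
  using cramer[OF assms(1), THEN iffD1, OF refl, of v] cramer[OF assms(1), THEN iffD1, of v' "char_matrix \<alpha> A s *v v"] assms(2)
  by simp

text \<open>On a closed half-disc times the unit sphere the norm of the image attains its minimum.
  This minimum is positive since the matrix is injective at each such \<open>s\<close>, also at
  \<open>s = 0\<close>. Homogeneity extends the estimate to all \<open>v\<close>.\<close>

lemma char_matrix_bounded_below:
  fixes A :: "complex^'d::finite^'d"
  assumes \<alpha>: "\<And>i. \<alpha> i > 0" and det: "\<And>s. Re s \<ge> 0 \<Longrightarrow> det (char_matrix \<alpha> A s) \<noteq> 0" and R: "R \<ge> 0"
  shows "\<exists>\<delta>>0. \<forall>s v. Re s \<ge> 0 \<longrightarrow> norm s \<le> R \<longrightarrow> \<delta> * norm v \<le> norm (char_matrix \<alpha> A s *v v)"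
proof -
  define K where "K = ({s. Re s \<ge> 0} \<inter> cball 0 R) \<times> (sphere 0 1 :: (complex^'d) set)"
  define f where "f = (\<lambda>(s, v). norm (char_matrix \<alpha> A s *v v))"
  have cpt: "compact K"
    unfolding K_def by (intro compact_Times closed_Int_compact compact_cball compact_sphere closed_halfspace_Re_ge)
  have "(0, axis undefined 1) \<in> K"
    using R by (simp add: K_def norm_axis_1)
  then have ne: "K \<noteq> {}" by blast
  have "continuous_on K (\<lambda>p. norm ((\<lambda>(s, v). char_matrix \<alpha> A s *v v) p))"
    by (rule continuous_on_norm, rule continuous_on_subset[OF continuous_on_char_matrix_mult_vec[OF \<alpha>]]) (auto simp: K_def)
  then have "continuous_on K f" by (simp add: f_def case_prod_beta')
  from continuous_attains_inf[OF cpt ne this] obtain p where p: "p \<in> K" "\<forall>q\<in>K. f p \<le> f q"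
    by blast
  obtain s0 v0 where p0: "p = (s0, v0)" by (cases p)
  define \<delta> where "\<delta> = norm (char_matrix \<alpha> A s0 *v v0)"
  have s0: "Re s0 \<ge> 0" and v0: "norm v0 = 1" using p(1) by (auto simp: K_def p0)
  have "char_matrix \<alpha> A s0 *v v0 \<noteq> 0"
  proof
    assume "char_matrix \<alpha> A s0 *v v0 = 0"
    then have "v0 = 0"
      using resolvent_unique[OF det[OF s0], of v0 0] by simp
    with v0 show False by simp
  qed
  then have \<delta>: "\<delta> > 0" by (simp add: \<delta>_def)
  have "\<delta> * norm v \<le> norm (char_matrix \<alpha> A s *v v)" if s: "Re s \<ge> 0" "norm s \<le> R" for s v
  proof (cases "v = 0")
    case False
    have "(s, (1 / norm v) *\<^sub>R v) \<in> K" using s False by (simp add: K_def)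
    with p(2) have "f p \<le> f (s, (1 / norm v) *\<^sub>R v)" by blast
    then have "\<delta> \<le> norm (char_matrix \<alpha> A s *v ((1 / norm v) *\<^sub>R v))"
      by (simp add: \<delta>_def p0 f_def)
    also have "char_matrix \<alpha> A s *v ((1 / norm v) *\<^sub>R v) = (1 / norm v) *\<^sub>R (char_matrix \<alpha> A s *v v)"
      by (simp add: vec_eq_iff char_matrix_mult_vec scaleR_right_diff_distrib scaleR_sum_right)
    finally show ?thesis using False by (simp add: field_simps)
  qed simp
  with \<delta> show ?thesis by blast
qed

text \<open>
  The weights \<open>min 1 (\<bar>s\<bar> powr (- \<alpha> i))\<close> make a single estimate serve both near \<open>0\<close>, where \<open>- A\<close>
  dominates, and near infinity, where the diagonal \<open>s powr \<alpha> i\<close> dominates.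
\<close>

lemma resolvent_bound:
  fixes A :: "complex^'d::finite^'d"
  assumes \<alpha>: "\<And>i. 0 < \<alpha> i \<and> \<alpha> i \<le> 1" and det: "\<And>s. Re s \<ge> 0 \<Longrightarrow> det (char_matrix \<alpha> A s) \<noteq> 0"
    and a: "0 < a" "\<And>i. a \<le> \<alpha> i"
  shows "\<exists>K\<ge>0. \<forall>s v. Re s \<ge> 0 \<longrightarrow> s \<noteq> 0 \<longrightarrow>
    (\<Sum>i\<in>UNIV. norm (v $ i)) \<le> K * (\<Sum>i\<in>UNIV. min 1 (norm s powr (- \<alpha> i)) * norm ((char_matrix \<alpha> A s *v v) $ i))"
proof -
  define S where "S = (\<Sum>i\<in>UNIV. \<Sum>j\<in>UNIV. norm (A $ i $ j))"
  have "S \<ge> 0" unfolding S_def by (intro sum_nonneg) auto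
  \<comment> \<open>Beyond \<open>R\<close> the coupling through \<open>A\<close> is small enough to
    be absorbed; within \<open>R\<close> the compactness bound applies.\<close>
  from ex_powr_minus_le_half[OF a(1) this] obtain R where R: "R \<ge> 1"
    "\<And>r. r \<ge> R \<Longrightarrow> r powr (- a) * S \<le> 1 / 2" by blast
  from char_matrix_bounded_below[of \<alpha> A R] obtain \<delta> where \<delta>: "\<delta> > 0"
    "\<And>s v. Re s \<ge> 0 \<Longrightarrow> norm s \<le> R \<Longrightarrow> \<delta> * norm v \<le> norm (char_matrix \<alpha> A s *v v)"
    using \<alpha> det R(1) by auto
  \<comment> \<open>The two arguments are the constants of the two cases: \<open>2\<close> from
    absorbing half of the sum for large \<open>s\<close>, the other from compactness for
    \<open>norm s \<le> R\<close>.\<close>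
  define K where "K = max 2 (real CARD('d) / \<delta> * R)"
  have K0: "K \<ge> 0" by (simp add: K_def)
  have "(\<Sum>i\<in>UNIV. norm (v $ i)) \<le> K * (\<Sum>i\<in>UNIV. min 1 (norm s powr (- \<alpha> i)) * norm ((char_matrix \<alpha> A s *v v) $ i))"
    if s: "Re s \<ge> 0" "s \<noteq> 0" for s v
  proof -
    define w where "w = char_matrix \<alpha> A s *v v"
    define Q where "Q = (\<Sum>i\<in>UNIV. min 1 (norm s powr (- \<alpha> i)) * norm (w $ i))"
    have Q0: "Q \<ge> 0" unfolding Q_def by (intro sum_nonneg) auto
    have "(\<Sum>i\<in>UNIV. norm (v $ i)) \<le> K * Q"
    proof (cases "norm s \<le> R")
      case True
      have "(\<Sum>i\<in>UNIV. norm (v $ i)) \<le> (\<Sum>i\<in>(UNIV :: 'd set). norm v)"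
        by (intro sum_mono Finite_Cartesian_Product.norm_nth_le)
      also have "\<dots> \<le> real CARD('d) / \<delta> * norm w"
        using \<delta>(2)[OF s(1) True, of v] \<delta>(1) by (simp add: w_def field_simps)
      also have "norm w \<le> (\<Sum>i\<in>UNIV. norm (w $ i))"
        unfolding norm_vec_def by (rule L2_set_le_sum) auto
      also have "\<dots> \<le> (\<Sum>i\<in>UNIV. R * (min 1 (norm s powr (- \<alpha> i)) * norm (w $ i)))"
      proof (rule sum_mono)
        fix i
        \<comment> \<open>For \<open>norm s \<le> R\<close> every weight is at least
          \<open>1 / R\<close>, because \<open>\<alpha> i \<le> 1\<close> and
          \<open>R \<ge> 1\<close>; so inserting the weights costs at most a factor
          \<open>R\<close>.\<close>
        have "1 / R = R powr (-1)" using R(1) by (simp add: powr_minus_divide)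
        also have "\<dots> \<le> R powr (- \<alpha> i)" using R(1) \<alpha>[of i] by (intro powr_mono) auto
        also have "\<dots> \<le> norm s powr (- \<alpha> i)" using True s \<alpha>[of i] by (intro powr_mono2') auto
        finally have "1 / R \<le> min 1 (norm s powr (- \<alpha> i))" using R(1) by simp
        then have "1 \<le> R * min 1 (norm s powr (- \<alpha> i))" using R(1) by (simp add: field_simps)
        from mult_right_mono[OF this norm_ge_zero[of "w $ i"]]
        show "norm (w $ i) \<le> R * (min 1 (norm s powr (- \<alpha> i)) * norm (w $ i))"
          by (simp add: mult.assoc)
      qed
      also have "\<dots> = R * Q" by (simp add: Q_def sum_distrib_left)
      finally have "(\<Sum>i\<in>UNIV. norm (v $ i)) \<le> real CARD('d) / \<delta> * (R * Q)"
        using \<delta>(1) by (simp add: mult_left_mono divide_right_mono)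
      also have "\<dots> = (real CARD('d) / \<delta> * R) * Q" by simp
      also have "\<dots> \<le> K * Q" using Q0 by (intro mult_right_mono) (auto simp: K_def)
      finally show ?thesis .
    next
      case False
      define r where "r = norm s"
      have r: "r \<ge> R" "r \<ge> 1" using False R by (auto simp: r_def)
      define Av where "Av = (\<lambda>i. \<Sum>j\<in>UNIV. A $ i $ j * v $ j)"
      \<comment> \<open>Row \<open>i\<close> is divided by its diagonal entry. For
        \<open>r \<ge> 1\<close> the weight is exactly \<open>r powr (- \<alpha> i)\<close>; in the
        coupling term it is relaxed to \<open>r powr (- a)\<close>, which is the same for all
        rows.\<close>
      have v_le: "norm (v $ i) \<le> min 1 (r powr (- \<alpha> i)) * norm (w $ i) + r powr (- a) * norm (Av i)" for i
      proof -
        have "s powr of_real (\<alpha> i) * v $ i = w $ i + Av i"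
          by (simp add: w_def char_matrix_mult_vec Av_def)
        then have "r powr \<alpha> i * norm (v $ i) = norm (w $ i + Av i)"
          by (metis Re_complex_of_real Reals_of_real norm_mult norm_powr_real_powr' r_def)
        also have "\<dots> \<le> norm (w $ i) + norm (Av i)" by (rule norm_triangle_ineq)
        finally have "r powr (- \<alpha> i) * (r powr \<alpha> i * norm (v $ i)) \<le> r powr (- \<alpha> i) * (norm (w $ i) + norm (Av i))"
          by (intro mult_left_mono) auto
        also have "r powr (- \<alpha> i) * (r powr \<alpha> i * norm (v $ i)) = norm (v $ i)"
          using r by (simp add: powr_minus)
        finally have "norm (v $ i) \<le> r powr (- \<alpha> i) * norm (w $ i) + r powr (- \<alpha> i) * norm (Av i)"
          by (simp add: distrib_left)
        moreover have "r powr (- \<alpha> i) \<le> r powr (- a)" using r a(2)[of i] by (intro powr_mono) auto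
        then have "r powr (- \<alpha> i) * norm (Av i) \<le> r powr (- a) * norm (Av i)" by (rule mult_right_mono) simp
        moreover have "r powr (- \<alpha> i) \<le> 1" using r \<alpha>[of i] powr_mono[of "- \<alpha> i" 0 r] by simp
        then have "min 1 (r powr (- \<alpha> i)) = r powr (- \<alpha> i)" by simp
        ultimately show ?thesis by simp
      qed
      define V where "V = (\<Sum>i\<in>UNIV. norm (v $ i))"
      have V0: "V \<ge> 0" unfolding V_def by (intro sum_nonneg) auto
      have "V \<le> (\<Sum>i\<in>UNIV. min 1 (r powr (- \<alpha> i)) * norm (w $ i) + r powr (- a) * norm (Av i))"
        unfolding V_def by (intro sum_mono v_le)
      also have "\<dots> = Q + r powr (- a) * (\<Sum>i\<in>UNIV. norm (Av i))"
        by (simp add: Q_def r_def sum.distrib sum_distrib_left)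
      also have "\<dots> \<le> Q + r powr (- a) * (S * V)"
        using sum_norm_matrix_le[of A v] by (intro add_left_mono mult_left_mono) (auto simp: Av_def S_def V_def)
      \<comment> \<open>By the choice of \<open>R\<close> the coupling contributes at most
        \<open>V / 2\<close>, which moves to the left-hand side.\<close>
      also have "\<dots> \<le> Q + 1 / 2 * V"
        using mult_right_mono[OF R(2)[OF r(1)] V0] by (simp add: mult.assoc)
      finally have "V \<le> 2 * Q" by simp
      also have "\<dots> \<le> K * Q" using Q0 by (intro mult_right_mono) (auto simp: K_def)
      finally show ?thesis by (simp add: V_def)
    qed
    then show ?thesis by (simp add: Q_def w_def)
  qed
  with K0 show ?thesis by blast
qed

lemma holomorphic_on_det:
  fixes M :: "complex \<Rightarrow> complex^'d::finite^'d"
  assumes "\<And>i j. (\<lambda>s. M s $ i $ j) holomorphic_on S"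
  shows "(\<lambda>s. det (M s)) holomorphic_on S"
  unfolding det_def by (intro holomorphic_intros assms)

text \<open>Cramer's rule gives each component as a quotient of determinants. Their entries are
  holomorphic off the branch cut, and the denominator has no zero in the half-plane.\<close>

lemma resolvent_exists:
  fixes A :: "complex^'d::finite^'d"
  assumes det: "\<And>s. Re s \<ge> 0 \<Longrightarrow> det (char_matrix \<alpha> A s) \<noteq> 0"
  shows "\<exists>Y. (\<forall>i. (\<lambda>s. Y s $ i) holomorphic_on {s. Re s > 0}) \<and>
    (\<forall>s. Re s > 0 \<longrightarrow> char_matrix \<alpha> A s *v Y s = (\<chi> i. s powr (of_real (\<alpha> i) - 1) * x0 $ i))"
proof -
  define b where "b = (\<lambda>s. \<chi> i. s powr (of_real (\<alpha> i) - 1) * x0 $ i)"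
  define Y where "Y = (\<lambda>s. \<chi> k. det (\<chi> i j. if j = k then b s $ i else char_matrix \<alpha> A s $ i $ j) / det (char_matrix \<alpha> A s))"
  have pos: "s \<notin> \<real>\<^sub>\<le>\<^sub>0" if "Re s > 0" for s
    using that by (auto simp: complex_nonpos_Reals_iff)
  have hb: "(\<lambda>s. b s $ i) holomorphic_on {s. Re s > 0}" for i
    unfolding b_def vec_lambda_beta by (intro holomorphic_intros) (auto simp: pos)
  have hM: "(\<lambda>s. char_matrix \<alpha> A s $ i $ j) holomorphic_on {s. Re s > 0}" for i j
    by (cases "i = j") (auto simp: char_matrix_def pos intro!: holomorphic_intros)
  have "(\<lambda>s. Y s $ k) holomorphic_on {s. Re s > 0}" for k
    unfolding Y_def vec_lambda_beta
  proof (intro holomorphic_on_divide holomorphic_on_det hM)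
    show "(\<lambda>s. (\<chi> i j. if j = k then b s $ i else char_matrix \<alpha> A s $ i $ j) $ i $ j) holomorphic_on {s. Re s > 0}" for i j
      using hb hM by (cases "j = k") simp_all
    show "\<And>s. s \<in> {s. Re s > 0} \<Longrightarrow> det (char_matrix \<alpha> A s) \<noteq> 0" using det by simp
  qed
  moreover have "char_matrix \<alpha> A s *v Y s = b s" if "Re s > 0" for s
    using cramer[OF det, of s] that by (simp add: Y_def)
  ultimately show ?thesis unfolding b_def by blast
qed

text \<open>\<open>resolvent_bound\<close> is used twice. Applied to \<open>Y\<close> it gives the
  order \<open>norm s powr (a - 1)\<close>. Differentiating the equation shows that
  \<open>Y'\<close> solves a system with the same matrix, whose right-hand side contains
  \<open>Y\<close>; the second application then gains one further power.\<close>

lemma resolvent_deriv_bound: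
  fixes A :: "complex^'d::finite^'d" and Y :: "complex \<Rightarrow> complex^'d"
  assumes \<alpha>: "\<And>i. 0 < \<alpha> i \<and> \<alpha> i \<le> 1" and det: "\<And>s. Re s \<ge> 0 \<Longrightarrow> det (char_matrix \<alpha> A s) \<noteq> 0"
    and a: "0 < a" "\<And>i. a \<le> \<alpha> i"
    and hol: "\<And>i. (\<lambda>s. Y s $ i) holomorphic_on {s. Re s > 0}"
    and Y: "\<And>s. Re s > 0 \<Longrightarrow> char_matrix \<alpha> A s *v Y s = (\<chi> i. s powr (of_real (\<alpha> i) - 1) * x0 $ i)"
  shows "\<exists>C\<ge>0. \<forall>i s. Re s > 0 \<longrightarrow> norm (deriv (\<lambda>s. Y s $ i) s) \<le> C * norm s powr (a - 2)"
proof -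
  from resolvent_bound[OF \<alpha> det a] obtain K where K: "K \<ge> 0"
    "\<And>s v. Re s \<ge> 0 \<Longrightarrow> s \<noteq> 0 \<Longrightarrow> (\<Sum>i\<in>UNIV. norm (v $ i)) \<le> K * (\<Sum>i\<in>UNIV. min 1 (norm s powr (- \<alpha> i)) * norm ((char_matrix \<alpha> A s *v v) $ i))"
    by auto
  define X0 where "X0 = (\<Sum>i\<in>UNIV. norm (x0 $ i))"
  have X0: "X0 \<ge> 0" unfolding X0_def by (intro sum_nonneg) auto
  have S: "open {s. Re s > 0}" by (simp add: open_halfspace_Re_gt)
  have "norm (deriv (\<lambda>s. Y s $ i) s) \<le> (K * ((1 + K) * X0)) * norm s powr (a - 2)" if s: "Re s > 0" for i s
  proof -
    define r where "r = norm s"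
    have s0: "s \<noteq> 0" and r: "r > 0" using s by (auto simp: r_def)
    define m where "m = (\<lambda>i. min 1 (r powr (- \<alpha> i)))"
    have m0: "m i \<ge> 0" for i by (simp add: m_def)
    have Kv: "(\<Sum>i\<in>UNIV. norm (v $ i)) \<le> K * (\<Sum>i\<in>UNIV. m i * norm ((char_matrix \<alpha> A s *v v) $ i))" for v
      using K(2)[of s v] s s0 by (simp add: m_def r_def)
    \<comment> \<open>The weight replaces the exponent \<open>\<alpha> i\<close> by a common
      \<open>b\<close>: below, \<open>b = a\<close> for the initial data and \<open>b = 0\<close>
      for the term containing \<open>Y\<close>. The shift \<open>q\<close> counts the derivatives of
      the power.\<close>
    have m: "m i * r powr (\<alpha> i + q) \<le> r powr (b + q)" if "0 \<le> b" "b \<le> \<alpha> i" for i b q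
      using mult_right_mono[OF min_powr_le[OF r that], of "r powr q"] by (simp add: m_def powr_add mult.assoc)
    have np: "norm (s powr (of_real x)) = r powr x" for x
      by (simp add: norm_powr_real_powr' r_def)
    have "(\<Sum>i\<in>UNIV. norm (Y s $ i)) \<le> K * (\<Sum>i\<in>UNIV. m i * norm (s powr (of_real (\<alpha> i) - 1) * x0 $ i))"
      using Kv[of "Y s"] Y[OF s] by simp
    also have "\<dots> \<le> K * (\<Sum>i\<in>UNIV. r powr (a - 1) * norm (x0 $ i))"
    proof (intro mult_left_mono sum_mono K)
      fix i
      have "m i * norm (s powr (of_real (\<alpha> i) - 1) * x0 $ i) = (m i * r powr (\<alpha> i + (-1))) * norm (x0 $ i)"
        using np[of "\<alpha> i - 1"] by (simp add: norm_mult)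
      also have "\<dots> \<le> r powr (a + (-1)) * norm (x0 $ i)"
        using a by (intro mult_right_mono m) (auto simp: less_imp_le)
      finally show "m i * norm (s powr (of_real (\<alpha> i) - 1) * x0 $ i) \<le> r powr (a - 1) * norm (x0 $ i)" by simp
    qed
    also have "\<dots> = K * r powr (a - 1) * X0" by (simp add: X0_def sum_distrib_left mult.assoc)
    finally have Ybd: "(\<Sum>i\<in>UNIV. norm (Y s $ i)) \<le> K * r powr (a - 1) * X0" .
    define Y' where "Y' = (\<chi> i. deriv (\<lambda>s. Y s $ i) s)"
    have dY: "((\<lambda>s. Y s $ i) has_field_derivative Y' $ i) (at s)" for i
      unfolding Y'_def vec_lambda_beta using holomorphic_derivI[OF hol S] s by simp
    have dpow: "((\<lambda>s. s powr of_real x) has_field_derivative of_real x * s powr (of_real x - 1)) (at s)" for x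
      using s by (intro has_field_derivative_powr) (auto simp: complex_nonpos_Reals_iff)
    \<comment> \<open>Row \<open>i\<close> of the equation for \<open>Y\<close>, differentiated; the
      product rule term in which the derivative falls on the diagonal power is moved to the
      right-hand side.\<close>
    have w: "(char_matrix \<alpha> A s *v Y') $ i = of_real (\<alpha> i - 1) * s powr of_real (\<alpha> i - 2) * x0 $ i - of_real (\<alpha> i) * s powr of_real (\<alpha> i - 1) * Y s $ i" for i
    proof -
      have "((\<lambda>s. s powr of_real (\<alpha> i) * Y s $ i - (\<Sum>j\<in>UNIV. A $ i $ j * Y s $ j)) has_field_derivative
         (of_real (\<alpha> i) * s powr (of_real (\<alpha> i) - 1) * Y s $ i + Y' $ i * s powr of_real (\<alpha> i)) - (\<Sum>j\<in>UNIV. A $ i $ j * Y' $ j)) (at s)"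
        by (rule DERIV_diff[OF DERIV_mult[OF dpow dY] DERIV_sum[OF DERIV_cmult[OF dY]]])
      moreover have "((\<lambda>s. s powr of_real (\<alpha> i - 1) * x0 $ i) has_field_derivative (of_real (\<alpha> i - 1) * s powr (of_real (\<alpha> i - 1) - 1)) * x0 $ i) (at s)"
        by (rule DERIV_cmult_right[OF dpow])
      then have "((\<lambda>s. s powr of_real (\<alpha> i) * Y s $ i - (\<Sum>j\<in>UNIV. A $ i $ j * Y s $ j)) has_field_derivative (of_real (\<alpha> i - 1) * s powr (of_real (\<alpha> i - 1) - 1)) * x0 $ i) (at s)"
      proof (rule has_field_derivative_transform_within_open[OF _ S])
        fix z assume "z \<in> {s. Re s > 0}"
        then have "(char_matrix \<alpha> A z *v Y z) $ i = z powr (of_real (\<alpha> i) - 1) * x0 $ i" using Y[of z] by simp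
        then show "z powr of_real (\<alpha> i - 1) * x0 $ i = z powr of_real (\<alpha> i) * Y z $ i - (\<Sum>j\<in>UNIV. A $ i $ j * Y z $ j)"
          by (simp add: char_matrix_mult_vec)
      qed (use s in simp)
      ultimately have "(of_real (\<alpha> i) * s powr (of_real (\<alpha> i) - 1) * Y s $ i + Y' $ i * s powr of_real (\<alpha> i)) - (\<Sum>j\<in>UNIV. A $ i $ j * Y' $ j)
        = (of_real (\<alpha> i - 1) * s powr (of_real (\<alpha> i - 1) - 1)) * x0 $ i"
        by (rule DERIV_unique)
      then show ?thesis by (simp add: char_matrix_mult_vec algebra_simps)
    qed
    have "norm (deriv (\<lambda>s. Y s $ i) s) \<le> (\<Sum>i\<in>UNIV. norm (Y' $ i))"
      using member_le_sum[of i UNIV "\<lambda>i. norm (Y' $ i)"] by (simp add: Y'_def)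
    also have "\<dots> \<le> K * (\<Sum>i\<in>UNIV. m i * norm ((char_matrix \<alpha> A s *v Y') $ i))" by (rule Kv)
    also have "\<dots> \<le> K * (\<Sum>i\<in>UNIV. r powr (a - 2) * norm (x0 $ i) + r powr (-1) * norm (Y s $ i))"
    proof (intro mult_left_mono sum_mono K)
      fix i
      have "norm ((char_matrix \<alpha> A s *v Y') $ i) \<le> \<bar>\<alpha> i - 1\<bar> * r powr (\<alpha> i - 2) * norm (x0 $ i) + \<bar>\<alpha> i\<bar> * r powr (\<alpha> i - 1) * norm (Y s $ i)"
        unfolding w by (rule order_trans[OF norm_triangle_ineq4]) (simp only: norm_mult np norm_of_real order_refl)
      also have "\<dots> \<le> 1 * r powr (\<alpha> i - 2) * norm (x0 $ i) + 1 * r powr (\<alpha> i - 1) * norm (Y s $ i)"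
        using \<alpha>[of i] by (intro add_mono mult_right_mono) auto
      finally have "m i * norm ((char_matrix \<alpha> A s *v Y') $ i) \<le> m i * (1 * r powr (\<alpha> i - 2) * norm (x0 $ i) + 1 * r powr (\<alpha> i - 1) * norm (Y s $ i))"
        by (rule mult_left_mono[OF _ m0])
      also have "\<dots> = (m i * r powr (\<alpha> i + (-2))) * norm (x0 $ i) + (m i * r powr (\<alpha> i + (-1))) * norm (Y s $ i)"
        by (simp add: algebra_simps)
      also have "\<dots> \<le> r powr (a + (-2)) * norm (x0 $ i) + r powr (0 + (-1)) * norm (Y s $ i)"
        using a \<alpha>[of i] by (intro add_mono mult_right_mono m) (auto simp: less_imp_le)
      finally show "m i * norm ((char_matrix \<alpha> A s *v Y') $ i) \<le> r powr (a - 2) * norm (x0 $ i) + r powr (-1) * norm (Y s $ i)"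
        by simp
    qed
    also have "\<dots> = K * (r powr (a - 2) * X0 + r powr (-1) * (\<Sum>i\<in>UNIV. norm (Y s $ i)))"
      by (simp add: sum.distrib sum_distrib_left X0_def)
    also have "\<dots> \<le> K * (r powr (a - 2) * X0 + r powr (-1) * (K * r powr (a - 1) * X0))"
      by (intro mult_left_mono add_left_mono Ybd K) auto
    also have "r powr (-1) * (K * r powr (a - 1) * X0) = K * X0 * (r powr (-1) * r powr (a - 1))" by simp
    also have "r powr (-1) * r powr (a - 1) = r powr (a - 2)"
      using powr_add[of r "-1" "a - 1"] by simp
    finally show ?thesis by (simp add: r_def algebra_simps)
  qed
  moreover have "K * ((1 + K) * X0) \<ge> 0" using K X0 by simp
  ultimately show ?thesis by blast
qed

section \<open>Solutions of the multi-order system\<close>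

text \<open>\<open>F\<close> carries the derivative of the transform from \<open>Re s > c\<close> to
  the whole half-plane. Inversion is done where the transform is known; then the line moves to
  \<open>Re s = 1 / t\<close>, where the exponential has constant size and the bound on
  \<open>F\<close> gives the rate \<open>t powr (- a)\<close>.\<close>

lemma laplace_decay:
  fixes f :: "real \<Rightarrow> complex"
  assumes f: "exp_integrable c f" and c: "c \<ge> 0" and M: "\<And>t. t \<ge> 0 \<Longrightarrow> norm (f t) \<le> M * exp (c * t)"
    and cont: "continuous_on {0<..} f"
    and hol: "F holomorphic_on {s. Re s > 0}"
    and bnd: "\<And>s. Re s > 0 \<Longrightarrow> norm (F s) \<le> C * norm s powr (a - 2)"
    and a: "0 < a" "a < 1"
    and F: "\<And>s. Re s > c \<Longrightarrow> F s = - laplace (\<lambda>t. of_real t * f t) s"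
  shows "(f \<longlongrightarrow> 0) at_top"
proof -
  \<comment> \<open>The extra damping \<open>exp (- u)\<close> pays for the factor \<open>u\<close>,
    so that \<open>g\<close> is bounded by \<open>M\<close>.\<close>
  define b where "b = c + 1"
  have b: "b > c" "b \<ge> 1" using c by (auto simp: b_def)
  define g where "g = (\<lambda>u. exp (- (b * u)) *\<^sub>R (of_real u * f u))"
  have f0: "f u = 0" if "u < 0" for u using f that by (simp add: exp_integrable_def)
  have M0: "M \<ge> 0" using order_trans[OF norm_ge_zero M[of 0]] by simp
  have int_g: "integrable lborel g"
    using exp_integrable_times[OF f] b by (simp add: exp_integrable_def g_def)
  have g_bnd: "norm (g u) \<le> M" for u
  proof (cases "u < 0")
    case True
    then show ?thesis using f0 M0 by (simp add: g_def)
  next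
    case False
    have "u \<le> exp u" using exp_ge_add_one_self[of u] by linarith
    have "norm (g u) = exp (- (b * u)) * (u * norm (f u))" using False by (simp add: g_def norm_mult)
    also have "\<dots> \<le> exp (- (b * u)) * (exp u * (M * exp (c * u)))"
      using False M[of u] \<open>u \<le> exp u\<close> by (intro mult_left_mono mult_mono) auto
    also have "\<dots> = M" by (simp add: b_def algebra_simps flip: exp_add)
    finally show ?thesis .
  qed
  \<comment> \<open>The Fourier transform of the damped function \<open>g\<close> is the Laplace
    transform of \<open>t * f t\<close> on the line \<open>Re s = b\<close>, which is
    \<open>- F\<close> there.\<close>
  define G where "G = (\<lambda>w. \<integral>u. iexp (- (w * u)) * g u \<partial>lborel)"
  have G: "G w = - F (Complex b w)" for w
  proof -
    have "iexp (- (w * u)) * g u = exp (- (Complex b w * of_real u)) * (of_real u * f u)" for u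
      by (simp add: g_def Complex_eq scaleR_conv_of_real exp_of_real [symmetric] algebra_simps exp_add [symmetric])
    then have "G w = laplace (\<lambda>t. of_real t * f t) (Complex b w)" by (simp add: G_def laplace_def)
    then show ?thesis using F[of "Complex b w"] b by simp
  qed
  have "integrable lborel (\<lambda>w. exp (0 *\<^sub>R Complex b w) * F (Complex b w))"
    using b by (intro vertical_line_integrable(1)[OF hol bnd a(2)]) auto
  moreover have "G = (\<lambda>w. - F (Complex b w))" by (simp add: G fun_eq_iff)
  ultimately have "integrable lborel G" by simp
  then have inv: "(\<integral>w. iexp (w * t) * G w \<partial>lborel) = of_real (2 * pi) * g t" if "t > 0" for t
    unfolding G_def
  proof (intro fourier_inversion[OF int_g _ g_bnd])
    have "isCont f t" using cont that by (simp add: continuous_on_eq_continuous_at)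
    then show "isCont g t" unfolding g_def by (intro continuous_intros)
  qed
  define I where "I = (\<integral>w. norm (Complex 1 w) powr (a - 2) \<partial>lborel)"
  \<comment> \<open>\<open>exp 1\<close> is the size of the exponential on the line
    \<open>Re s = 1 / t\<close>, and \<open>2 * pi\<close> comes from Fourier inversion.\<close>
  define L where "L = exp 1 * C * I / (2 * pi)"
  have le: "norm (f t) \<le> L * t powr (- a)" if t: "t \<ge> 1" for t
  proof -
    have "of_real (2 * pi * t) * f t = exp (t * b) *\<^sub>R (of_real (2 * pi) * g t)"
      by (simp add: g_def scaleR_conv_of_real exp_of_real [symmetric] mult.commute[of t b]) (simp flip: exp_add)
    also have "\<dots> = exp (t * b) *\<^sub>R (\<integral>w. iexp (w * t) * G w \<partial>lborel)"
      using inv[of t] t by simp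
    also have "\<dots> = (\<integral>w. exp (t * b) *\<^sub>R (iexp (w * t) * G w) \<partial>lborel)" by simp
    also have "\<dots> = (\<integral>w. - (exp (t *\<^sub>R Complex b w) * F (Complex b w)) \<partial>lborel)"
      by (intro Bochner_Integration.integral_cong)
        (simp_all add: G Complex_eq scaleR_conv_of_real exp_of_real [symmetric] distrib_left exp_add mult_ac)
    also have "\<dots> = - (\<integral>w. exp (t *\<^sub>R Complex b w) * F (Complex b w) \<partial>lborel)" by simp
    also have "(\<integral>w. exp (t *\<^sub>R Complex b w) * F (Complex b w) \<partial>lborel) = (\<integral>w. exp (t *\<^sub>R Complex (1 / t) w) * F (Complex (1 / t) w) \<partial>lborel)"
    proof -
      have "1 / t \<le> 1" using t by simp
      with b have "1 / t \<le> b" by linarith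
      then show ?thesis using t by (intro contour_shift[OF hol bnd a(2), symmetric]) auto
    qed
    finally have "norm (of_real (2 * pi * t) * f t) = norm (\<integral>w. exp (t *\<^sub>R Complex (1 / t) w) * F (Complex (1 / t) w) \<partial>lborel)"
      by (simp only: norm_minus_cancel)
    also have "\<dots> \<le> exp (t * (1 / t)) * (C * ((1 / t) powr (a - 1) * I))"
      unfolding I_def using t by (intro vertical_line_integrable(2)[OF hol bnd a(2)]) auto
    also have "\<dots> = exp 1 * C * I * (1 / t) powr (a - 1)" using t by simp
    \<comment> \<open>One factor \<open>t\<close> is split off to cancel the \<open>t\<close> that
      multiplies \<open>f t\<close>.\<close>
    also have "(1 / t) powr (a - 1) = t * t powr (- a)"
      using t by (simp add: powr_divide powr_diff powr_minus field_simps)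
    finally have "2 * pi * t * norm (f t) \<le> 2 * pi * t * (L * t powr (- a))"
      using t by (simp add: norm_mult L_def mult_ac)
    then show ?thesis using t by simp
  qed
  show ?thesis
  proof (rule Lim_null_comparison)
    show "eventually (\<lambda>t. norm (f t) \<le> L * t powr (- a)) at_top"
      using eventually_ge_at_top[of 1] by eventually_elim (rule le)
    show "((\<lambda>t. L * t powr (- a)) \<longlongrightarrow> 0) at_top"
      using a by (intro tendsto_mult_right_zero tendsto_neg_powr filterlim_ident) simp
  qed
qed

section \<open>Growth and Laplace transform of solutions of the Volterra equation\<close>

lemma multi_order_solution_convolution:
  fixes A :: "complex^'d::finite^'d"
  assumes \<alpha>: "\<And>i. 0 < \<alpha> i" and sol: "multi_order_solution \<alpha> A x0 x" and t: "t \<ge> 0"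
  defines "F \<equiv> (\<lambda>i u. indicator {0..} u *\<^sub>R (\<Sum>j\<in>UNIV. A $ i $ j * x u $ j))"
  shows "integrable lborel (\<lambda>u. of_real (rl_kernel (\<alpha> i) (t - u)) * F i u)"
    and "x t $ i = x0 $ i + (\<integral>u. of_real (rl_kernel (\<alpha> i) (t - u)) * F i u \<partial>lborel)"
proof -
  have cont: "continuous_on {0..} (\<lambda>u. \<Sum>j\<in>UNIV. A $ i $ j * x u $ j)"
    using sol unfolding multi_order_solution_def by (intro continuous_intros) auto
  show "integrable lborel (\<lambda>u. of_real (rl_kernel (\<alpha> i) (t - u)) * F i u)"
    unfolding F_def by (rule rl_integral_eq_convolution(1)[OF \<alpha> t cont])
  show "x t $ i = x0 $ i + (\<integral>u. of_real (rl_kernel (\<alpha> i) (t - u)) * F i u \<partial>lborel)"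
    unfolding F_def using sol t rl_integral_eq_convolution(2)[OF \<alpha> t cont]
    by (simp add: multi_order_solution_def)
qed

text \<open>On \<open>{0..T}\<close> let \<open>m\<close> be the maximum of the norm weighted by
  \<open>exp (- (c * t))\<close>. At a maximizer the Volterra equation gives
  \<open>m \<le> X0 + m / 2\<close>, hence \<open>m \<le> 2 * X0\<close>, a bound that does not
  depend on \<open>T\<close>.\<close>

lemma multi_order_solution_exp_bound:
  fixes A :: "complex^'d::finite^'d"
  assumes a: "0 < a" "\<And>i. a \<le> \<alpha> i" and sol: "multi_order_solution \<alpha> A x0 x"
  shows "\<exists>c\<ge>1. \<exists>M. \<forall>t\<ge>0. (\<Sum>i\<in>UNIV. norm (x t $ i)) \<le> M * exp (c * t)"
proof -
  have \<alpha>: "\<alpha> i > 0" for i using a(1) a(2)[of i] by linarith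
  define B where "B = (\<lambda>i. \<Sum>j\<in>UNIV. norm (A $ i $ j))"
  define S where "S = (\<Sum>i\<in>UNIV. B i)"
  have B0: "B i \<ge> 0" for i unfolding B_def by (intro sum_nonneg) auto
  then have "S \<ge> 0" unfolding S_def by (intro sum_nonneg) auto
  \<comment> \<open>The kernel of order \<open>\<alpha> i\<close>, weighted at rate
    \<open>c\<close>, has mass \<open>c powr (- \<alpha> i)\<close>, at most
    \<open>c powr (- a)\<close> as \<open>c \<ge> 1\<close>. This choice makes the weighted integral
    operator contract by \<open>1 / 2\<close>.\<close>
  from ex_powr_minus_le_half[OF a(1) this] obtain c where c: "c \<ge> 1" "c powr (- a) * S \<le> 1 / 2" by blast
  define N where "N = (\<lambda>t. \<Sum>i\<in>UNIV. norm (x t $ i))"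
  define X0 where "X0 = (\<Sum>i\<in>UNIV. norm (x0 $ i))"
  have cont: "continuous_on {0..} x" using sol by (simp add: multi_order_solution_def)
  have "N T \<le> 2 * X0 * exp (c * T)" if T: "T \<ge> 0" for T
  proof -
    have "continuous_on {0..T} (\<lambda>t. exp (- (c * t)) * N t)"
      unfolding N_def by (intro continuous_intros continuous_on_subset[OF cont]) auto
    from continuous_attains_sup[OF _ _ this] T obtain t where t: "t \<in> {0..T}"
      "\<And>u. u \<in> {0..T} \<Longrightarrow> exp (- (c * u)) * N u \<le> exp (- (c * t)) * N t" by auto
    define m where "m = exp (- (c * t)) * N t"
    have N0: "N u \<ge> 0" for u unfolding N_def by (intro sum_nonneg) auto
    then have m0: "m \<ge> 0" by (simp add: m_def)
    have Nu: "N u \<le> m * exp (c * u)" if "u \<in> {0..T}" for u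
      using t(2)[OF that] by (simp add: m_def exp_minus field_simps)
    define F where "F = (\<lambda>i u. indicator {0..} u *\<^sub>R (\<Sum>j\<in>UNIV. A $ i $ j * x u $ j))"
    have t0: "t \<ge> 0" using t by simp
    have conv: "integrable lborel (\<lambda>u. of_real (rl_kernel (\<alpha> i) (t - u)) * F i u)"
      "x t $ i = x0 $ i + (\<integral>u. of_real (rl_kernel (\<alpha> i) (t - u)) * F i u \<partial>lborel)" for i
      unfolding F_def by (fact multi_order_solution_convolution[OF \<alpha> sol t0])+
    have x_le: "norm (x t $ i) \<le> norm (x0 $ i) + c powr (- a) * B i * (m * exp (c * t))" for i
    proof -
      have int: "integrable lborel (\<lambda>u. B i * (m * exp (c * t)) * (exp (- (c * (t + (-1) * u))) * rl_kernel (\<alpha> i) (t + (-1) * u)))"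
        using lborel_integrable_real_affine[OF rl_kernel_laplace_real(1)[OF \<alpha>, of c i], of "-1" t] c
        by (intro integrable_mult_right) auto
      have "norm (\<integral>u. of_real (rl_kernel (\<alpha> i) (t - u)) * F i u \<partial>lborel)
         \<le> (\<integral>u. B i * (m * exp (c * t)) * (exp (- (c * (t + (-1) * u))) * rl_kernel (\<alpha> i) (t + (-1) * u)) \<partial>lborel)"
      proof (rule norm_lebesgue_integral_le[OF conv(1) int])
        fix u
        show "norm (of_real (rl_kernel (\<alpha> i) (t - u)) * F i u) \<le> B i * (m * exp (c * t)) * (exp (- (c * (t + (-1) * u))) * rl_kernel (\<alpha> i) (t + (-1) * u))"
        proof (cases "0 \<le> u \<and> u < t")
          case False
          then have zero: "of_real (rl_kernel (\<alpha> i) (t - u)) * F i u = 0"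
            by (auto simp: rl_kernel_def F_def)
          show ?thesis unfolding zero using B0 m0 rl_kernel_nonneg[OF \<alpha>] by simp
        next
          case True
          have "norm (F i u) \<le> (\<Sum>j\<in>UNIV. norm (A $ i $ j) * norm (x u $ j))"
            using True by (auto simp: F_def norm_mult intro!: order_trans[OF norm_sum])
          also have "\<dots> \<le> (\<Sum>j\<in>UNIV. norm (A $ i $ j) * N u)"
            unfolding N_def by (intro sum_mono mult_left_mono member_le_sum) auto
          also have "\<dots> = B i * N u" by (simp add: B_def sum_distrib_right)
          also have "\<dots> \<le> B i * (m * exp (c * u))" using True t by (intro mult_left_mono Nu B0) auto
          finally have "rl_kernel (\<alpha> i) (t - u) * norm (F i u) \<le> rl_kernel (\<alpha> i) (t - u) * (B i * (m * exp (c * u)))"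
            by (intro mult_left_mono rl_kernel_nonneg \<alpha>)
          \<comment> \<open>Moving the weight from \<open>u\<close> to \<open>t\<close> leaves on
            the kernel a damping in \<open>t - u\<close>, whose integral is the known Laplace
            transform.\<close>
          also have "exp (c * u) = exp (c * t) * exp (- (c * (t - u)))"
            by (simp add: algebra_simps flip: exp_add)
          finally show ?thesis using rl_kernel_nonneg[OF \<alpha>] by (simp add: norm_mult mult_ac)
        qed
      qed
      also have "\<dots> = B i * (m * exp (c * t)) * (\<integral>u. exp (- (c * (t + (-1) * u))) * rl_kernel (\<alpha> i) (t + (-1) * u) \<partial>lborel)"
        by (rule integral_mult_right_zero)
      also have "(\<integral>u. exp (- (c * (t + (-1) * u))) * rl_kernel (\<alpha> i) (t + (-1) * u) \<partial>lborel) = c powr (- \<alpha> i)"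
        using lborel_integral_real_affine[of "-1" "\<lambda>v. exp (- (c * v)) * rl_kernel (\<alpha> i) v" t]
          rl_kernel_laplace_real(2)[OF \<alpha>, of c i] c by simp
      also have "B i * (m * exp (c * t)) * c powr (- \<alpha> i) \<le> B i * (m * exp (c * t)) * c powr (- a)"
        using c a(2)[of i] B0 m0 by (intro mult_left_mono powr_mono) auto
      finally have "norm (\<integral>u. of_real (rl_kernel (\<alpha> i) (t - u)) * F i u \<partial>lborel) \<le> c powr (- a) * B i * (m * exp (c * t))"
        by (simp add: mult_ac)
      then show ?thesis unfolding conv(2)[of i] by (intro norm_triangle_le) simp
    qed
    have "N t \<le> (\<Sum>i\<in>UNIV. norm (x0 $ i) + c powr (- a) * B i * (m * exp (c * t)))"
      unfolding N_def by (intro sum_mono x_le)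
    also have "\<dots> = X0 + c powr (- a) * S * (m * exp (c * t))"
      by (simp add: X0_def S_def sum.distrib sum_distrib_left sum_distrib_right)
    also have "\<dots> \<le> X0 + 1 / 2 * (m * exp (c * t))"
      using c m0 by (intro add_left_mono mult_right_mono) auto
    finally have "exp (- (c * t)) * N t \<le> exp (- (c * t)) * (X0 + 1 / 2 * (m * exp (c * t)))"
      by (rule mult_left_mono) simp
    also have "\<dots> = exp (- (c * t)) * X0 + m / 2"
      by (simp add: algebra_simps exp_minus)
    also have "exp (- (c * t)) * X0 \<le> 1 * X0"
      using c t by (intro mult_right_mono) (auto simp: X0_def intro!: sum_nonneg)
    finally have "m \<le> 2 * X0" by (simp add: m_def)
    then have "m * exp (c * T) \<le> 2 * X0 * exp (c * T)" by (rule mult_right_mono) simp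
    from order_trans[OF Nu[of T] this] T show ?thesis by auto
  qed
  then show ?thesis using c(1) unfolding N_def by blast
qed

text \<open>After multiplication by \<open>exp (- (s * of_real t))\<close> the Volterra equation
  still has convolution form, so its integral is an algebraic relation; multiplying by
  \<open>s powr \<alpha> i\<close> yields row \<open>i\<close>. The condition
  \<open>c \<ge> 0\<close> ensures that the kernels too have a transform at
  \<open>s\<close>.\<close>

lemma multi_order_solution_laplace:
  fixes A :: "complex^'d::finite^'d"
  assumes \<alpha>: "\<And>i. 0 < \<alpha> i" and sol: "multi_order_solution \<alpha> A x0 x"
    and c: "c \<ge> 0" and M: "\<And>t. t \<ge> 0 \<Longrightarrow> (\<Sum>i\<in>UNIV. norm (x t $ i)) \<le> M * exp (c * t)"
  defines "f \<equiv> (\<lambda>i t. indicator {0..} t *\<^sub>R x t $ i)"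
  shows "exp_integrable c (f i)"
    and "Re s > c \<Longrightarrow> char_matrix \<alpha> A s *v (\<chi> i. laplace (f i) s) = (\<chi> i. s powr (of_real (\<alpha> i) - 1) * x0 $ i)"
proof -
  have cont: "continuous_on {0..} x" using sol by (simp add: multi_order_solution_def)
  have fm[measurable]: "f i \<in> borel_measurable borel" for i
    unfolding f_def by (intro borel_measurable_continuous_on_indicator continuous_intros cont) auto
  have f_le: "norm (f i t) \<le> M * exp (c * t)" if "t \<ge> 0" for i t
    using member_le_sum[of i UNIV "\<lambda>i. norm (x t $ i)"] M[OF that] that by (simp add: f_def)
  have M0: "M \<ge> 0" using order_trans[OF norm_ge_zero f_le[of 0]] by simp
  show fi: "exp_integrable c (f i)" for i
    unfolding exp_integrable_def
  proof (intro conjI allI impI fm)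
    show "f i t = 0" if "t < 0" for t using that by (simp add: f_def)
    fix b assume b: "b > c"
    show "integrable lborel (\<lambda>t. exp (- (b * t)) *\<^sub>R f i t)"
    proof (rule Bochner_Integration.integrable_bound)
      \<comment> \<open>\<open>rl_kernel 1\<close> is \<open>1\<close> on the positive reals and so
        supplies a one-sided exponential as majorant. At \<open>0\<close> it is \<open>0\<close>,
        hence the domination only almost everywhere.\<close>
      show "integrable lborel (\<lambda>t. M * (exp (- ((b - c) * t)) * rl_kernel 1 t))"
        using b by (intro integrable_mult_right rl_kernel_laplace_real) auto
      show "AE t in lborel. norm (exp (- (b * t)) *\<^sub>R f i t) \<le> norm (M * (exp (- ((b - c) * t)) * rl_kernel 1 t))"
        using AE_lborel_singleton[of 0]
      proof eventually_elim
        case (elim t)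
        show ?case
        proof (cases "t < 0")
          case True
          then show ?thesis by (simp add: f_def)
        next
          case False
          have "norm (exp (- (b * t)) *\<^sub>R f i t) \<le> exp (- (b * t)) * (M * exp (c * t))"
            using f_le[of t i] False by simp
          also have "\<dots> = M * exp (- ((b - c) * t))" by (simp add: algebra_simps flip: exp_add)
          finally show ?thesis using False elim M0 by (simp add: rl_kernel_def)
        qed
      qed
    qed measurable
  qed
  assume s: "Re s > c"
  have spos: "Re s > 0" and s0: "s \<noteq> 0" using s c by auto
  have "(char_matrix \<alpha> A s *v (\<chi> i. laplace (f i) s)) $ i = s powr (of_real (\<alpha> i) - 1) * x0 $ i" for i
  proof -
    define F where "F = (\<lambda>u. indicator {0..} u *\<^sub>R (\<Sum>j\<in>UNIV. A $ i $ j * x u $ j))"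
    define k where "k = (\<lambda>t. exp (- (s * of_real t)) * complex_of_real (rl_kernel (\<alpha> i) t))"
    define Fs where "Fs = (\<lambda>u. exp (- (s * of_real u)) * F u)"
    have F_f: "F u = (\<Sum>j\<in>UNIV. A $ i $ j * f j u)" for u
      by (simp add: F_def f_def scaleR_sum_right)
    have Fs: "Fs u = (\<Sum>j\<in>UNIV. A $ i $ j * (exp (- (s * of_real u)) * f j u))" for u
      by (simp add: Fs_def F_f sum_distrib_left mult_ac)
    have int_Fs: "integrable lborel Fs"
      unfolding Fs by (intro Bochner_Integration.integrable_sum integrable_mult_right integrable_laplace_integrand[OF fi s])
    have Fs_int: "(\<integral>u. Fs u \<partial>lborel) = (\<Sum>j\<in>UNIV. A $ i $ j * laplace (f j) s)"
      unfolding Fs laplace_def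
      by (subst Bochner_Integration.integral_sum) (auto intro!: integrable_mult_right integrable_laplace_integrand[OF fi s])
    have int_k: "integrable lborel k"
      unfolding k_def using exp_integrable_rl_kernel[OF \<alpha>] spos by (intro integrable_laplace_integrand)
    have k_int: "(\<integral>t. k t \<partial>lborel) = s powr (- of_real (\<alpha> i))"
      using laplace_rl_kernel[OF \<alpha> spos, of i] by (simp add: laplace_def k_def)
    \<comment> \<open>\<open>rl_kernel 1\<close> is the unit step except at \<open>0\<close>, so \<open>eq\<close> below holds only almost everywhere.\<close>
    define k1 where "k1 = (\<lambda>t. exp (- (s * of_real t)) * complex_of_real (rl_kernel 1 t))"
    have int_k1: "integrable lborel k1"
      unfolding k1_def using spos by (intro integrable_laplace_integrand[OF exp_integrable_rl_kernel]) auto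
    have k1_int: "(\<integral>t. k1 t \<partial>lborel) = 1 / s"
      using laplace_rl_kernel[of 1 s] spos s0 powr_minus[of s 1] by (simp add: laplace_def k1_def divide_inverse)
    have eq: "exp (- (s * of_real t)) * f i t = k1 t * x0 $ i + (\<integral>u. k (t - u) * Fs u \<partial>lborel)" if "t \<noteq> 0" for t
    proof -
      \<comment> \<open>The exponential weight at \<open>t\<close> factors into its weights at
        \<open>t - u\<close> and \<open>u\<close>, so it can be taken out of the
        convolution.\<close>
      have "k (t - u) * Fs u = exp (- (s * of_real t)) * (of_real (rl_kernel (\<alpha> i) (t - u)) * F u)" for u
      proof -
        have "exp (- (s * of_real (t - u))) * exp (- (s * of_real u)) = exp (- (s * of_real t))"
          by (simp add: algebra_simps flip: exp_add)
        then show ?thesis by (simp add: k_def Fs_def mult_ac)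
      qed
      then have conv: "(\<integral>u. k (t - u) * Fs u \<partial>lborel) = exp (- (s * of_real t)) * (\<integral>u. of_real (rl_kernel (\<alpha> i) (t - u)) * F u \<partial>lborel)"
        by simp
      show ?thesis
      proof (cases "t < 0")
        case True
        have "of_real (rl_kernel (\<alpha> i) (t - u)) * F u = 0" for u
          using True by (auto simp: rl_kernel_def F_def)
        then have "(\<integral>u. of_real (rl_kernel (\<alpha> i) (t - u)) * F u \<partial>lborel) = 0"
          by (simp only: Bochner_Integration.integral_zero)
        then show ?thesis unfolding conv using True by (simp add: f_def k1_def rl_kernel_def)
      next
        case False
        then have t: "t > 0" using that by simp
        have "x t $ i = x0 $ i + (\<integral>u. of_real (rl_kernel (\<alpha> i) (t - u)) * F u \<partial>lborel)"
          unfolding F_def using t by (intro multi_order_solution_convolution(2)[OF \<alpha> sol]) simp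
        then show ?thesis unfolding conv using t by (simp add: f_def k1_def rl_kernel_def distrib_left)
      qed
    qed
    have "laplace (f i) s = (\<integral>t. k1 t * x0 $ i + (\<integral>u. k (t - u) * Fs u \<partial>lborel) \<partial>lborel)"
      unfolding laplace_def
    proof (rule integral_cong_AE)
      show "AE t in lborel. exp (- (s * of_real t)) * f i t = k1 t * x0 $ i + (\<integral>u. k (t - u) * Fs u \<partial>lborel)"
        using AE_lborel_singleton[of 0] by eventually_elim (rule eq)
      show "(\<lambda>t. k1 t * x0 $ i + (\<integral>u. k (t - u) * Fs u \<partial>lborel)) \<in> borel_measurable lborel"
        using int_k1 convolution_integral(1)[OF int_k int_Fs]
        by (intro borel_measurable_add borel_measurable_times) auto
    qed measurable
    also have "\<dots> = 1 / s * x0 $ i + s powr (- of_real (\<alpha> i)) * (\<Sum>j\<in>UNIV. A $ i $ j * laplace (f j) s)"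
      using int_k1 convolution_integral[OF int_k int_Fs] by (simp add: k1_int k_int Fs_int)
    finally have "s powr of_real (\<alpha> i) * laplace (f i) s
      = s powr of_real (\<alpha> i) * (1 / s * x0 $ i + s powr (- of_real (\<alpha> i)) * (\<Sum>j\<in>UNIV. A $ i $ j * laplace (f j) s))"
      by simp
    also have "\<dots> = s powr (of_real (\<alpha> i) - 1) * x0 $ i + (\<Sum>j\<in>UNIV. A $ i $ j * laplace (f j) s)"
      using s0 by (simp add: powr_diff powr_minus field_simps)
    finally show ?thesis by (simp add: char_matrix_mult_vec)
  qed
  then show "char_matrix \<alpha> A s *v (\<chi> i. laplace (f i) s) = (\<chi> i. s powr (of_real (\<alpha> i) - 1) * x0 $ i)"
    by (simp add: vec_eq_iff)
qed

theorem theorem3p7: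
  fixes \<alpha> :: "'d::finite \<Rightarrow> real" and A :: "complex^'d^'d"
  assumes "\<And>i. 0 < \<alpha> i \<and> \<alpha> i \<le> 1"
    and "\<And>s. det (char_matrix \<alpha> A s) = 0 \<Longrightarrow> Re s < 0"
  shows "\<forall>x0 x. multi_order_solution \<alpha> A x0 x \<longrightarrow> (x \<longlongrightarrow> 0) at_top"
proof (intro allI impI)
  fix x0 x assume sol: "multi_order_solution \<alpha> A x0 x"
  \<comment> \<open>This covers the closed half-plane; at \<open>s = 0\<close> it says that
    \<open>A\<close> is invertible.\<close>
  have det: "det (char_matrix \<alpha> A s) \<noteq> 0" if "Re s \<ge> 0" for s
    using assms(2)[of s] that by auto
  have \<alpha>0: "\<alpha> i > 0" for i using assms(1) by simp
  \<comment> \<open>The cap \<open>1 / 2\<close> keeps \<open>a < 1\<close> even if every order is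
    \<open>1\<close>; this makes \<open>norm s powr (a - 2)\<close> integrable along vertical
    lines.\<close>
  define a where "a = min (1 / 2) (Min (range \<alpha>))"
  have a: "0 < a" "a < 1" "a \<le> \<alpha> i" for i
    using \<alpha>0 by (auto simp: a_def min_le_iff_disj)
  from multi_order_solution_exp_bound[OF a(1,3) sol] obtain c M where c: "c \<ge> 1"
    and M: "\<And>t. t \<ge> 0 \<Longrightarrow> (\<Sum>i\<in>UNIV. norm (x t $ i)) \<le> M * exp (c * t)" by blast
  have c0: "c \<ge> 0" using c by simp
  define f where "f = (\<lambda>i t. indicator {0..} t *\<^sub>R x t $ i)"
  have f_int: "exp_integrable c (f i)" for i
    unfolding f_def by (rule multi_order_solution_laplace(1)[OF \<alpha>0 sol c0], rule M)
  have f_laplace: "char_matrix \<alpha> A s *v (\<chi> i. laplace (f i) s) = (\<chi> i. s powr (of_real (\<alpha> i) - 1) * x0 $ i)"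
    if "Re s > c" for s
    unfolding f_def by (rule multi_order_solution_laplace(2)[OF \<alpha>0 sol c0 _ that], rule M)
  from resolvent_exists[OF det, of x0] obtain Y where
    hol: "\<And>i. (\<lambda>s. Y s $ i) holomorphic_on {s. Re s > 0}" and
    Y: "\<And>s. Re s > 0 \<Longrightarrow> char_matrix \<alpha> A s *v Y s = (\<chi> i. s powr (of_real (\<alpha> i) - 1) * x0 $ i)"
    by blast
  have "\<exists>C\<ge>0. \<forall>i s. Re s > 0 \<longrightarrow> norm (deriv (\<lambda>s. Y s $ i) s) \<le> C * norm s powr (a - 2)"
    by (rule resolvent_deriv_bound) (fact assms(1) det a hol Y)+
  then obtain C where
    C: "\<And>i s. Re s > 0 \<Longrightarrow> norm (deriv (\<lambda>s. Y s $ i) s) \<le> C * norm s powr (a - 2)"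
    by blast
  \<comment> \<open>For \<open>Re s > c\<close> both vectors solve the same uniquely solvable linear
    system, so \<open>Y\<close> continues the transform of the solution to
    \<open>Re s > 0\<close>.\<close>
  have Y_laplace: "Y s $ i = laplace (f i) s" if "Re s > c" for s i
  proof -
    have s: "Re s \<ge> 0" "Re s > 0" using that c by auto
    have "Y s = (\<chi> i. laplace (f i) s)"
      by (rule resolvent_unique[OF det[OF s(1)]]) (simp add: Y[OF s(2)] f_laplace[OF that])
    then show ?thesis by simp
  qed
  have "((\<lambda>t. x t $ i) \<longlongrightarrow> 0) at_top" for i
  proof -
    have "(f i \<longlongrightarrow> 0) at_top"
    proof (rule laplace_decay[OF f_int c0 _ _ _ _ a(1,2)])
      show "norm (f i t) \<le> M * exp (c * t)" if "t \<ge> 0" for t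
        using member_le_sum[of i UNIV "\<lambda>i. norm (x t $ i)"] M[OF that] that by (simp add: f_def)
      have "continuous_on {0<..} (\<lambda>t. x t $ i)"
        using sol unfolding multi_order_solution_def
        by (intro continuous_intros) (auto elim: continuous_on_subset)
      then show "continuous_on {0<..} (f i)"
        by (rule continuous_on_eq) (simp add: f_def)
      show "deriv (\<lambda>s. Y s $ i) holomorphic_on {s. Re s > 0}"
        by (intro holomorphic_deriv hol open_halfspace_Re_gt)
      show "norm (deriv (\<lambda>s. Y s $ i) s) \<le> C * norm s powr (a - 2)" if "Re s > 0" for s
        using that by (rule C)
      fix s assume s: "Re s > c"
      \<comment> \<open>The agreement with the transform holds on the open half-plane
        \<open>Re s > c\<close>, so it passes to derivatives.\<close>
      have "((\<lambda>s. Y s $ i) has_field_derivative - laplace (\<lambda>t. of_real t * f i t) s) (at s)"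
        using laplace_has_field_derivative[OF f_int s]
        by (rule has_field_derivative_transform_within_open[OF _ open_halfspace_Re_gt[of c]])
          (use s in \<open>auto simp: Y_laplace\<close>)
      then show "deriv (\<lambda>s. Y s $ i) s = - laplace (\<lambda>t. of_real t * f i t) s"
        by (rule DERIV_imp_deriv)
    qed
    moreover have "eventually (\<lambda>t. f i t = x t $ i) at_top"
      using eventually_ge_at_top[of 0] by eventually_elim (simp add: f_def)
    ultimately show ?thesis by (rule Lim_transform_eventually)
  qed
  then show "(x \<longlongrightarrow> 0) at_top"
    by (intro vec_tendstoI) simp
qed

end
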